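(* Let $n$ be a positive integer. Consider the following decision problem (Directed MinMax-Betweenness restricted to linear profiles): given a directed MinMax-profile $F$ on $[n]\cup\{0,n+1\}$ which is linear, decide whether there exists a permutation $P$ of $[n]\cup\{0,n+1\}$ (with $0$ in the first position and $n+1$ in the last position) whose directed MinMax-profile is exactly $F$. This problem can be solved in time polynomial in $n$.
   Context: $[n]=\{1,\dots,n\}$. Permutations are of $[n]\cup\{0,n+1\}$, always with $0$ at the leftmost position and $n+1$ at the rightmost position. For a permutation $P$ and $0\le t\le n$, let $\min_t$ and $\max_t$ be the minimum and maximum of the elements located on $P$ in the interval delimited by the element $t$ (included) and the element $t+1$ (included). The directed MinMax-profile of $P$ is the collection, for $0\le t\le n$, of the triples $(t,t+1,[\min_t,\max_t])$ together with the information whether $t$ is to the left or to the right of $t+1$ in $P$. A directed MinMax-profile on $[n]\cup\{0,n+1\}$ (in general) is a collection $F$ of constraints, one for each $0\le t\le n$, consisting of integers $m_t,M_t$ with $0\le m_t\le t<t+1\le M_t\le n+1$ together with a specification of whether $t$ is to the left or right of $t+1$. Such an $F$ is linear if the intervals $[m_t..M_t]=\{x\in\mathbb Z: m_t\le x\le M_t\}$, $1\le t\le n-1$, are totally ordered by inclusion. *)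

theory Defs
  imports Main
begin

text \<open>A directed MinMax-profile on [n] \<union> {0,n+1} is given by three functions:
  m t and M t (the claimed min and max for the pair t, t+1) and
  d t (True iff t is claimed to be to the LEFT of t+1), for 0 \<le> t \<le> n.
  Values of these functions for t > n are irrelevant.\<close>

definition is_profile :: "nat \<Rightarrow> (nat \<Rightarrow> nat) \<Rightarrow> (nat \<Rightarrow> nat) \<Rightarrow> bool" where
  "is_profile n m M \<longleftrightarrow> (\<forall>t\<le>n. m t \<le> t \<and> t + 1 \<le> M t \<and> M t \<le> n + 1)"

definition linear_profile :: "nat \<Rightarrow> (nat \<Rightarrow> nat) \<Rightarrow> (nat \<Rightarrow> nat) \<Rightarrow> bool" where
  "linear_profile n m M \<longleftrightarrow>
     (\<forall>s\<in>{1..n-1}. \<forall>t\<in>{1..n-1}. {m s..M s} \<subseteq> {m t..M t} \<or> {m t..M t} \<subseteq> {m s..M s})"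

text \<open>A permutation of {0..n+1} with 0 first and n+1 last, represented by its
  position function: pos x is the position (0-based) of the element x.\<close>

definition is_perm_pos :: "nat \<Rightarrow> (nat \<Rightarrow> nat) \<Rightarrow> bool" where
  "is_perm_pos n pos \<longleftrightarrow> bij_betw pos {0..n+1} {0..n+1} \<and> pos 0 = 0 \<and> pos (n+1) = n+1"

definition between_set :: "nat \<Rightarrow> (nat \<Rightarrow> nat) \<Rightarrow> nat \<Rightarrow> nat set" where
  "between_set n pos t =
     {x\<in>{0..n+1}. min (pos t) (pos (t+1)) \<le> pos x \<and> pos x \<le> max (pos t) (pos (t+1))}"

definition has_profile ::
  "nat \<Rightarrow> (nat \<Rightarrow> nat) \<Rightarrow> (nat \<Rightarrow> nat) \<Rightarrow> (nat \<Rightarrow> nat) \<Rightarrow> (nat \<Rightarrow> bool) \<Rightarrow> bool" where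
  "has_profile n pos m M d \<longleftrightarrow>
     (\<forall>t\<le>n. Min (between_set n pos t) = m t \<and> Max (between_set n pos t) = M t
            \<and> (d t \<longleftrightarrow> pos t < pos (t+1)))"

definition realizable :: "nat \<Rightarrow> (nat \<Rightarrow> nat) \<Rightarrow> (nat \<Rightarrow> nat) \<Rightarrow> (nat \<Rightarrow> bool) \<Rightarrow> bool" where
  "realizable n m M d \<longleftrightarrow> (\<exists>pos. is_perm_pos n pos \<and> has_profile n pos m M d)"

datatype instr =
    Const nat nat
  | Add nat nat nat
  | Sub nat nat nat
  | Load nat nat
  | Store nat nat
  | Jz nat nat
  | Jmp nat
  | Halt

type_synonym config = "nat \<times> (nat \<Rightarrow> nat)"

definition halted :: "instr list \<Rightarrow> config \<Rightarrow> bool" where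
  "halted p c \<longleftrightarrow> fst c \<ge> length p \<or> p ! fst c = Halt"

fun exec :: "instr \<Rightarrow> config \<Rightarrow> config" where
  "exec (Const r k) (pc, R) = (pc + 1, R(r := k))"
| "exec (Add r a b) (pc, R) = (pc + 1, R(r := R a + R b))"
| "exec (Sub r a b) (pc, R) = (pc + 1, R(r := R a - R b))"
| "exec (Load r a) (pc, R) = (pc + 1, R(r := R (R a)))"
| "exec (Store a r) (pc, R) = (pc + 1, R(R a := R r))"
| "exec (Jz r l) (pc, R) = (if R r = 0 then l else pc + 1, R)"
| "exec (Jmp l) (pc, R) = (l, R)"
| "exec Halt (pc, R) = (pc, R)"

definition step :: "instr list \<Rightarrow> config \<Rightarrow> config" where
  "step p c = (if halted p c then c else exec (p ! fst c) c)"

definition halts_within :: "instr list \<Rightarrow> (nat \<Rightarrow> nat) \<Rightarrow> nat \<Rightarrow> nat \<Rightarrow> bool" where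
  "halts_within p R0 s out \<longleftrightarrow>
     halted p ((step p ^^ s) (0, R0)) \<and> snd ((step p ^^ s) (0, R0)) 0 = out"

text \<open>Input encoding: R[0] = n; for 0 \<le> t \<le> n: R[3t+1] = m t, R[3t+2] = M t,
  R[3t+3] = 1 if t is left of t+1 and 0 otherwise; all other registers 0.\<close>

definition encode ::
  "nat \<Rightarrow> (nat \<Rightarrow> nat) \<Rightarrow> (nat \<Rightarrow> nat) \<Rightarrow> (nat \<Rightarrow> bool) \<Rightarrow> nat \<Rightarrow> nat" where
  "encode n m M d i =
     (if i = 0 then n
      else if i \<le> 3 * n + 3 then
        (let t = (i - 1) div 3 in
          if (i - 1) mod 3 = 0 then m t
          else if (i - 1) mod 3 = 1 then M t
          else (if d t then 1 else 0))
      else 0)"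

end

theory Submission
  imports Defs
begin

text \<open>Collect the order relations a realizing permutation is forced to have: \<open>0\<close> comes first and \<open>n + 1\<close>
  last, the claimed minimum and maximum of a pair lie between its two (directed) ends, the order is
  transitive, and an element \<open>a\<close> outside \<open>[m t .. M t]\<close> lies on the same side of \<open>t\<close> and \<open>t + 1\<close>.
  For linear profiles the profile is realizable iff this closure is irreflexive.  Indeed, in a closed
  strict partial order that is not total choose, among the elements having an incomparable partner,
  an \<open>x\<close> that is outside as many of the intervals as possible (by linearity these sets of intervals
  form a chain).  Putting everything not below \<open>x\<close> above \<open>x\<close> and above all elements below \<open>x\<close>
  gives a larger closed strict partial order, so a maximal one is total, and it is the required
  permutation.  The closure is computed by \<open>(n + 2)\<^sup>2\<close> passes applying all rules.\<close>

section \<open>The forced order\<close>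

text \<open>Adding a single pair to a closed order may trigger the rules for outside elements again
  and again, with no control over cycles. A cut adds the whole product of a down-set and its
  complement at once, so transitivity and irreflexivity come for free; the only danger is that it
  separates \<open>t\<close> from \<open>t + 1\<close> while some element outside
  \<open>[m t .. M t]\<close> is incomparable to them. If \<open>x\<close> is itself outside that
  interval, the rules already put \<open>t\<close> and \<open>t + 1\<close> on the same side of the
  cut. One \<open>x\<close> must serve all intervals that matter, and the chain property provides
  it: the largest of the sets contains all the others. Linearity says nothing about
  \<open>t = 0\<close> and \<open>t = n\<close>, but there one element of the pair is
  \<open>0\<close> or \<open>n + 1\<close>, which is comparable to everything. The least closed
  relation makes the criterion algorithmic: rules only add pairs, there are at most
  \<open>(n + 2) * (n + 2)\<close> of them, and a pass that adds nothing has reached the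
  closure.\<close>

definition left_end :: "(nat \<Rightarrow> bool) \<Rightarrow> nat \<Rightarrow> nat" where
  "left_end d t = (if d t then t else t + 1)"

definition right_end :: "(nat \<Rightarrow> bool) \<Rightarrow> nat \<Rightarrow> nat" where
  "right_end d t = (if d t then t + 1 else t)"

definition outside :: "(nat \<Rightarrow> nat) \<Rightarrow> (nat \<Rightarrow> nat) \<Rightarrow> nat \<Rightarrow> nat \<Rightarrow> bool" where
  "outside m M a t \<longleftrightarrow> a < m t \<or> M t < a"

text \<open>Pairs with equal components are dropped because \<open>m t\<close> or \<open>M t\<close>
  may itself be an end of the interval, and \<open>a\<close> may be \<open>0\<close> or
  \<open>n + 1\<close>; keeping them would destroy irreflexivity.\<close>

definition unconditional ::
  "nat \<Rightarrow> (nat \<Rightarrow> nat) \<Rightarrow> (nat \<Rightarrow> nat) \<Rightarrow> (nat \<Rightarrow> bool) \<Rightarrow> nat \<Rightarrow> nat \<Rightarrow> (nat \<times> nat) set" where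
  "unconditional n m M d a t =
     {(x, y) \<in> {(0, a), (a, n + 1), (left_end d t, m t), (m t, right_end d t),
                (left_end d t, M t), (M t, right_end d t)}. x \<noteq> y}"

text \<open>One instance of every rule, indexed by a single triple: \<open>t\<close> is both the
  index of a pair and the middle element for transitivity, so three nested loops run through all
  instances.\<close>

definition conseqs ::
  "nat \<Rightarrow> (nat \<Rightarrow> nat) \<Rightarrow> (nat \<Rightarrow> nat) \<Rightarrow> (nat \<Rightarrow> bool) \<Rightarrow> (nat \<times> nat) set \<Rightarrow>
   nat \<Rightarrow> nat \<Rightarrow> nat \<Rightarrow> (nat \<times> nat) set" where
  "conseqs n m M d X a t c =
     unconditional n m M d a t
     \<union> (if (a, t) \<in> X \<and> (t, c) \<in> X then {(a, c)} else {})
     \<union> (if outside m M a t \<and> ((a, t) \<in> X \<or> (a, t + 1) \<in> X) then {(a, t), (a, t + 1)} else {})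
     \<union> (if outside m M a t \<and> ((t, a) \<in> X \<or> (t + 1, a) \<in> X) then {(t, a), (t + 1, a)} else {})"

definition closed_rel ::
  "nat \<Rightarrow> (nat \<Rightarrow> nat) \<Rightarrow> (nat \<Rightarrow> nat) \<Rightarrow> (nat \<Rightarrow> bool) \<Rightarrow> (nat \<times> nat) set \<Rightarrow> bool" where
  "closed_rel n m M d X \<longleftrightarrow>
     (\<forall>a\<le>n+1. \<forall>t\<le>n. \<forall>c\<le>n+1. conseqs n m M d X a t c \<subseteq> X)"

definition forced ::
  "nat \<Rightarrow> (nat \<Rightarrow> nat) \<Rightarrow> (nat \<Rightarrow> nat) \<Rightarrow> (nat \<Rightarrow> bool) \<Rightarrow> (nat \<times> nat) set" where
  "forced n m M d = \<Inter>{X. closed_rel n m M d X}"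

lemma closed_relD:
  assumes "closed_rel n m M d X" "a \<le> n + 1" "t \<le> n" "c \<le> n + 1"
  shows "conseqs n m M d X a t c \<subseteq> X"
  using assms unfolding closed_rel_def by blast

lemma conseqs_mono: "X \<subseteq> Y \<Longrightarrow> conseqs n m M d X a t c \<subseteq> conseqs n m M d Y a t c"
  unfolding conseqs_def by (intro Un_mono) (simp_all split: if_split, blast+)

lemma forced_least: "closed_rel n m M d X \<Longrightarrow> forced n m M d \<subseteq> X"
  unfolding forced_def by blast

lemma closed_rel_forced: "closed_rel n m M d (forced n m M d)"
  unfolding closed_rel_def
proof (intro allI impI)
  fix a t c assume le: "a \<le> n + 1" "t \<le> n" "c \<le> n + 1"
  show "conseqs n m M d (forced n m M d) a t c \<subseteq> forced n m M d"
  proof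
    fix p assume p: "p \<in> conseqs n m M d (forced n m M d) a t c"
    show "p \<in> forced n m M d" unfolding forced_def
    proof (rule InterI)
      fix X assume "X \<in> {X. closed_rel n m M d X}"
      then have X: "closed_rel n m M d X" by simp
      show "p \<in> X"
        using p conseqs_mono[OF forced_least[OF X]] closed_relD[OF X le] by blast
    qed
  qed
qed

lemma forced_square:
  assumes "is_profile n m M"
  shows "forced n m M d \<subseteq> {..n+1} \<times> {..n+1}"
proof (rule forced_least)
  show "closed_rel n m M d ({..n+1} \<times> {..n+1})"
    unfolding closed_rel_def
  proof (intro allI impI)
    fix a t c assume le: "a \<le> n + 1" "t \<le> n" "c \<le> n + 1"
    have "m t \<le> t" "t + 1 \<le> M t" "M t \<le> n + 1" using assms le by (auto simp: is_profile_def)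
    then show "conseqs n m M d ({..n+1} \<times> {..n+1}) a t c \<subseteq> {..n+1} \<times> {..n+1}"
      using le unfolding conseqs_def unconditional_def left_end_def right_end_def by auto
  qed
qed

section \<open>Necessity: the positions in a realizing permutation obey the rules\<close>

lemma between_set_ends:
  "t \<le> n \<Longrightarrow> t \<in> between_set n pos t \<and> t + 1 \<in> between_set n pos t"
  by (auto simp: between_set_def)

lemma finite_between_set: "finite (between_set n pos t)"
  by (simp add: between_set_def)

text \<open>An element outside \<open>[m t .. M t]\<close> cannot be positioned between
  \<open>t\<close> and \<open>t + 1\<close>, since it would then enter the minimum or the maximum;
  so it is to the left of both or to the right of both.\<close>

lemma closed_rel_pos_less:
  assumes perm: "is_perm_pos n pos" and prof: "has_profile n pos m M d"
  shows "closed_rel n m M d {(x, y). x \<le> n + 1 \<and> y \<le> n + 1 \<and> pos x < pos y}" (is "closed_rel n m M d ?X")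
  unfolding closed_rel_def
proof (intro allI impI)
  fix a t c assume le: "a \<le> n + 1" "t \<le> n" "c \<le> n + 1"
  let ?B = "between_set n pos t"
  have inj: "inj_on pos {0..n+1}" and ends: "pos 0 = 0" "pos (n + 1) = n + 1"
    and img: "pos ` {0..n+1} = {0..n+1}"
    using perm by (auto simp: is_perm_pos_def bij_betw_def)
  have eq: "pos x = pos y \<longleftrightarrow> x = y" if "x \<le> n + 1" "y \<le> n + 1" for x y
    using inj_on_eq_iff[OF inj] that by auto
  have bound: "pos x \<le> n + 1" if "x \<le> n + 1" for x using img that by fastforce
  have B: "finite ?B" "?B \<noteq> {}" using between_set_ends[OF le(2), of pos] finite_between_set by auto
  have minmax: "m t = Min ?B" "M t = Max ?B" "d t \<longleftrightarrow> pos t < pos (t + 1)"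
    using prof le(2) by (auto simp: has_profile_def)
  have mB: "m t \<in> ?B" and MB: "M t \<in> ?B" using minmax B by auto
  have neq: "pos t \<noteq> pos (t + 1)" using eq[of t "t + 1"] le by auto
  have lr: "pos (left_end d t) = min (pos t) (pos (t + 1))" "pos (right_end d t) = max (pos t) (pos (t + 1))"
    "left_end d t \<le> n + 1" "right_end d t \<le> n + 1"
    using minmax(3) neq le by (auto simp: left_end_def right_end_def)
  have uncond: "unconditional n m M d a t \<subseteq> ?X"
  proof -
    have "x \<le> n + 1 \<and> pos (left_end d t) \<le> pos x \<and> pos x \<le> pos (right_end d t)" if "x \<in> {m t, M t}" for x
      using that mB MB lr by (auto simp: between_set_def)
    note mt = this[of "m t"] and Mt = this[of "M t"]
    have "0 < pos a" if "a \<noteq> 0" using eq[of a 0] that ends le by auto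
    moreover have "pos a < n + 1" if "a \<noteq> n + 1" using eq[of a "n + 1"] that ends le bound[of a] by auto
    moreover have lt: "pos x < pos y" if "x \<le> n + 1" "y \<le> n + 1" "x \<noteq> y" "pos x \<le> pos y" for x y
      using that eq[of x y] by auto
    ultimately show ?thesis
      using mt Mt lr(3,4) ends le lt[of "left_end d t" "m t"] lt[of "m t" "right_end d t"]
        lt[of "left_end d t" "M t"] lt[of "M t" "right_end d t"]
      unfolding unconditional_def by auto
  qed
  have out: "pos a < min (pos t) (pos (t + 1)) \<or> max (pos t) (pos (t + 1)) < pos a" if "outside m M a t"
  proof (rule ccontr)
    assume "\<not> ?thesis"
    then have "a \<in> ?B" using le by (auto simp: between_set_def)
    then have "m t \<le> a" "a \<le> M t" using minmax B by auto
    then show False using that by (auto simp: outside_def)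
  qed
  show "conseqs n m M d ?X a t c \<subseteq> ?X"
    using uncond out le unfolding conseqs_def by (auto split: if_splits)
qed

lemma realizable_imp_irrefl_forced:
  assumes "realizable n m M d"
  shows "irrefl (forced n m M d)"
proof -
  obtain pos where "is_perm_pos n pos" "has_profile n pos m M d"
    using assms by (auto simp: realizable_def)
  from forced_least[OF closed_rel_pos_less[OF this]] show ?thesis
    by (auto simp: irrefl_def)
qed

section \<open>Sufficiency: enlarging a closed strict order by cuts\<close>

locale closed_order =
  fixes n :: nat and m M :: "nat \<Rightarrow> nat" and d :: "nat \<Rightarrow> bool" and X :: "(nat \<times> nat) set"
  assumes profile: "is_profile n m M"
    and closed: "closed_rel n m M d X"
    and square: "X \<subseteq> {..n+1} \<times> {..n+1}"
    and irrefl: "irrefl X"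
begin

lemma conseqs_subset: "a \<le> n + 1 \<Longrightarrow> t \<le> n \<Longrightarrow> c \<le> n + 1 \<Longrightarrow> conseqs n m M d X a t c \<subseteq> X"
  using closed closed_relD by blast

lemma unconditional_subset: "a \<le> n + 1 \<Longrightarrow> t \<le> n \<Longrightarrow> unconditional n m M d a t \<subseteq> X"
  using conseqs_subset[of a t a] unfolding conseqs_def by blast

lemma zero_less: "a \<le> n + 1 \<Longrightarrow> a \<noteq> 0 \<Longrightarrow> (0, a) \<in> X"
  and less_top: "a \<le> n + 1 \<Longrightarrow> a \<noteq> n + 1 \<Longrightarrow> (a, n + 1) \<in> X"
  using unconditional_subset[of a 0] unfolding unconditional_def by auto

lemma in_range: "(a, b) \<in> X \<Longrightarrow> a \<le> n + 1 \<and> b \<le> n + 1 \<and> a \<noteq> b"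
  using square irrefl by (auto simp: irrefl_def)

text \<open>The rules compose only at elements \<open>t \<le> n\<close>; nothing lies above \<open>n + 1\<close> in an irreflexive order.\<close>
lemma transitive:
  assumes "(a, b) \<in> X" "(b, c) \<in> X" shows "(a, c) \<in> X"
proof -
  have mid: "(x, z) \<in> X" if "(x, y) \<in> X" "(y, z) \<in> X" "y \<le> n" for x y z
    using conseqs_subset[of x y z] that in_range unfolding conseqs_def by auto
  have "b \<noteq> n + 1"
  proof
    assume b: "b = n + 1"
    then have "c \<le> n" "(c, b) \<in> X" using in_range[OF assms(2)] less_top[of c] by auto
    then show False using mid[OF assms(2), of b] in_range by blast
  qed
  then show ?thesis using mid[OF assms] in_range[OF assms(1)] by auto
qed

lemma asym: "(a, b) \<in> X \<Longrightarrow> (b, a) \<notin> X"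
  using transitive in_range by blast

lemma outside_right:
  assumes "outside m M a t" "t \<le> n" shows "(a, t) \<in> X \<longleftrightarrow> (a, t + 1) \<in> X"
proof -
  have "a \<le> n + 1 \<Longrightarrow> ?thesis"
    using conseqs_subset[of a t a] assms unfolding conseqs_def by auto
  then show ?thesis using in_range by blast
qed

lemma outside_left:
  assumes "outside m M a t" "t \<le> n" shows "(t, a) \<in> X \<longleftrightarrow> (t + 1, a) \<in> X"
proof -
  have "a \<le> n + 1 \<Longrightarrow> ?thesis"
    using conseqs_subset[of a t a] assms unfolding conseqs_def by auto
  then show ?thesis using in_range by blast
qed

definition incomparable :: "nat \<Rightarrow> nat \<Rightarrow> bool" where
  "incomparable a b \<longleftrightarrow> a \<le> n + 1 \<and> b \<le> n + 1 \<and> a \<noteq> b \<and> (a, b) \<notin> X \<and> (b, a) \<notin> X"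

text \<open>For \<open>t = 0\<close> the element \<open>a\<close> is above \<open>0\<close>, for
  \<open>t = n\<close> it is below \<open>n + 1\<close>, and the outside rules carry this over to
  the other element of the pair. Incomparability thus leaves only the indices to which linearity
  applies.\<close>

lemma outside_comparable_end:
  assumes "outside m M a t" "t \<le> n" "incomparable a s" "s \<in> {t, t + 1}"
  shows "t \<in> {1..n-1}"
proof -
  have a: "a \<le> n + 1" using assms by (auto simp: incomparable_def)
  have p: "m t \<le> t" "t + 1 \<le> M t" "M t \<le> n + 1" using profile assms by (auto simp: is_profile_def)
  have *: "(t, a) \<notin> X" "(a, t) \<notin> X" "(t + 1, a) \<notin> X" "(a, t + 1) \<notin> X"
    using assms outside_left[OF assms(1,2)] outside_right[OF assms(1,2)] by (auto simp: incomparable_def)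
  have "t \<noteq> 0"
  proof
    assume "t = 0"
    then show False using * zero_less[OF a] assms(1) p by (auto simp: outside_def)
  qed
  moreover have "t \<noteq> n"
  proof
    assume "t = n"
    then show False using * less_top[OF a] assms(1) p a by (auto simp: outside_def)
  qed
  ultimately show ?thesis using assms(2) by auto
qed

text \<open>Cutting the order just above \<^term>\<open>x\<close> respects the rules because every element that can be
  moved by the cut is outside no more intervals than \<^term>\<open>x\<close> is.\<close>
lemma cut:
  assumes x: "incomparable x y"
    and max: "\<And>a b t. incomparable a b \<Longrightarrow> t \<in> {1..n-1} \<Longrightarrow> outside m M a t \<Longrightarrow> outside m M x t"
  shows "\<exists>X'. X \<subset> X' \<and> closed_order n m M d X'"
proof -
  define D where "D = insert x {a. (a, x) \<in> X}"
  define E where "E = {b. b \<le> n + 1 \<and> b \<notin> D}"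
  define X' where "X' = X \<union> D \<times> E"
  have Dle: "a \<le> n + 1" if "a \<in> D" for a using that x in_range by (auto simp: D_def incomparable_def)
  have D_down: "a \<in> D" if "(a, b) \<in> X" "b \<in> D" for a b using that transitive by (auto simp: D_def)
  have E_up: "b \<in> E" if "(a, b) \<in> X" "a \<in> E" for a b using that D_down in_range by (auto simp: E_def)
  have DE: "a \<notin> E" if "a \<in> D" for a using that by (auto simp: E_def)
  have tr: "(a, c) \<in> X'" if "(a, b) \<in> X'" "(b, c) \<in> X'" for a b c
    using that transitive D_down E_up DE unfolding X'_def by blast
  have new: "incomparable a b" if "(a, b) \<in> X'" "(a, b) \<notin> X" for a b
    using that Dle DE D_down[of b a] by (auto simp: incomparable_def X'_def E_def)
  \<comment> \<open>The cut never separates such a pair: \<open>x\<close> is also outside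
    \<open>[m t .. M t]\<close>, so it differs from \<open>t\<close> and \<open>t + 1\<close>, and
    the rules put both of them below \<open>x\<close> or neither.\<close>
  have same: "s \<in> D \<longleftrightarrow> s' \<in> D"
    if o: "outside m M a t" "t \<le> n" "incomparable a s" and s: "{s, s'} = {t, t + 1}" for a t s s'
  proof -
    have "t \<in> {1..n-1}" by (rule outside_comparable_end[OF o]) (use s in blast)
    then have ox: "outside m M x t" using max[OF o(3)] o(1) by blast
    have "m t \<le> t" "t + 1 \<le> M t" using profile o(2) by (auto simp: is_profile_def)
    then have "x \<noteq> t" "x \<noteq> t + 1" using ox by (auto simp: outside_def)
    then have "t \<in> D \<longleftrightarrow> t + 1 \<in> D" using outside_left[OF ox o(2)] by (auto simp: D_def)
    then show ?thesis using s by (auto simp: doubleton_eq_iff)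
  qed
  have right: "(a, s') \<in> X'"
    if o: "outside m M a t" "t \<le> n" and as: "(a, s) \<in> X'" and s: "{s, s'} = {t, t + 1}" for a t s s'
  proof (cases "(a, s) \<in> X")
    case True
    then have "(a, s') \<in> X" using outside_right[OF o] s by (auto simp: doubleton_eq_iff)
    then show ?thesis by (simp add: X'_def)
  next
    case False
    then have aD: "a \<in> D" and sE: "s \<in> E" using as by (auto simp: X'_def)
    have "s \<notin> D" using sE by (auto simp: E_def)
    then have "s' \<notin> D" using same[OF o new[OF as False] s] by simp
    moreover have "s' \<le> n + 1" using s o(2) by (auto simp: doubleton_eq_iff)
    ultimately show ?thesis using aD by (auto simp: X'_def E_def)
  qed
  have left: "(s', a) \<in> X'"
    if o: "outside m M a t" "t \<le> n" and sa: "(s, a) \<in> X'" and s: "{s, s'} = {t, t + 1}" for a t s s'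
  proof (cases "(s, a) \<in> X")
    case True
    then have "(s', a) \<in> X" using outside_left[OF o] s by (auto simp: doubleton_eq_iff)
    then show ?thesis by (simp add: X'_def)
  next
    case False
    then have sD: "s \<in> D" and aE: "a \<in> E" using sa by (auto simp: X'_def)
    have "incomparable a s" using new[OF sa False] by (auto simp: incomparable_def)
    then have "s' \<in> D" using same[OF o _ s] sD by blast
    then show ?thesis using aE by (auto simp: X'_def)
  qed
  have "closed_rel n m M d X'"
    unfolding closed_rel_def
  proof (intro allI impI)
    fix a t c assume le: "a \<le> n + 1" "t \<le> n" "c \<le> n + 1"
    have "unconditional n m M d a t \<subseteq> X'" using unconditional_subset[OF le(1,2)] by (auto simp: X'_def)
    moreover have "(a, t) \<in> X' \<and> (a, t + 1) \<in> X'"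
      if "outside m M a t" "(a, t) \<in> X' \<or> (a, t + 1) \<in> X'"
      using that right[OF that(1) le(2)] by (metis insert_commute)
    moreover have "(t, a) \<in> X' \<and> (t + 1, a) \<in> X'"
      if "outside m M a t" "(t, a) \<in> X' \<or> (t + 1, a) \<in> X'"
      using that left[OF that(1) le(2)] by (metis insert_commute)
    ultimately show "conseqs n m M d X' a t c \<subseteq> X'"
      using tr[of a t c] unfolding conseqs_def by (intro Un_least) (simp_all split: if_split, blast+)
  qed
  moreover have "X' \<subseteq> {..n+1} \<times> {..n+1}" using square Dle by (auto simp: X'_def E_def)
  moreover have "irrefl X'" using irrefl DE by (auto simp: irrefl_def X'_def)
  \<comment> \<open>The pair \<open>(x, y)\<close> is new: \<open>x\<close> is in \<open>D\<close>,
    while \<open>y\<close>, being incomparable to \<open>x\<close>, is not.\<close>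
  moreover have "X \<subset> X'"
    using x unfolding X'_def D_def E_def incomparable_def by blast
  ultimately show ?thesis using profile by (intro exI[of _ X']) (simp add: closed_order_def)
qed

lemma extend:
  assumes lin: "linear_profile n m M" and xy: "incomparable x y"
  shows "\<exists>X'. X \<subset> X' \<and> closed_order n m M d X'"
proof -
  define outs where "outs a = {t \<in> {1..n-1}. outside m M a t}" for a
  define bad where "bad = {a. \<exists>b. incomparable a b}"
  have fin: "finite bad" by (rule finite_subset[of _ "{..n+1}"]) (auto simp: bad_def incomparable_def)
  have "x \<in> bad" using xy by (auto simp: bad_def)
  then obtain z where z: "z \<in> bad" "\<And>a. a \<in> bad \<Longrightarrow> card (outs a) \<le> card (outs z)"
    using Max_in[of "(\<lambda>a. card (outs a)) ` bad"] Max_ge[of "(\<lambda>a. card (outs a)) ` bad"] fin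
    by (smt (verit) empty_iff finite_imageI image_iff image_is_empty)
  have finO: "finite (outs a)" for a by (simp add: outs_def)
  \<comment> \<open>If neither set contained the other, \<open>b\<close> would be in interval
    \<open>s\<close> but not in \<open>t\<close>, and \<open>a\<close> in \<open>t\<close> but not
    in \<open>s\<close>, so these two intervals would not be nested.\<close>
  have chain: "outs a \<subseteq> outs b \<or> outs b \<subseteq> outs a" for a b
  proof (rule ccontr)
    assume "\<not> ?thesis"
    then obtain s t where st: "s \<in> outs a" "s \<notin> outs b" "t \<in> outs b" "t \<notin> outs a" by blast
    then have "{m s..M s} \<subseteq> {m t..M t} \<or> {m t..M t} \<subseteq> {m s..M s}"
      using lin by (auto simp: linear_profile_def outs_def)
    moreover have "b \<in> {m s..M s}" "a \<notin> {m s..M s}" "a \<in> {m t..M t}" "b \<notin> {m t..M t}"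
      using st by (auto simp: outs_def outside_def)
    ultimately show False by blast
  qed
  \<comment> \<open>In a chain of finite sets, one of largest cardinality contains all the
    others.\<close>
  have sub: "outs a \<subseteq> outs z" if "a \<in> bad" for a
    using chain[of a z] z(2)[OF that] card_seteq[OF finO[of a], of "outs z"] by blast
  obtain w where w: "incomparable z w" using z(1) by (auto simp: bad_def)
  show ?thesis
  proof (rule cut[OF w])
    fix a b t assume "incomparable a b" "t \<in> {1..n-1}" "outside m M a t"
    then show "outside m M z t" using sub[of a] by (auto simp: bad_def outs_def)
  qed
qed

end

section \<open>From a closed order to a permutation\<close>

lemma total_extension:
  assumes "closed_order n m M d X" "linear_profile n m M"
  shows "\<exists>Y. closed_order n m M d Y \<and> (\<forall>a\<le>n+1. \<forall>b\<le>n+1. a = b \<or> (a, b) \<in> Y \<or> (b, a) \<in> Y)"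
  using assms(1)
proof (induction "card ({..n+1} \<times> {..n+1} - X)" arbitrary: X rule: less_induct)
  case less
  interpret closed_order n m M d X by fact
  show ?case
  proof (cases "\<exists>x y. incomparable x y")
    case True
    then obtain x y where xy: "incomparable x y" by blast
    from extend[OF assms(2) xy]
    obtain X' where X': "X \<subset> X'" "closed_order n m M d X'" by blast
    have "X' \<subseteq> {..n+1} \<times> {..n+1}" using closed_order.square[OF X'(2)] .
    then have "card ({..n+1} \<times> {..n+1} - X') < card ({..n+1} \<times> {..n+1} - X)"
      using X'(1) by (intro psubset_card_mono) auto
    then show ?thesis using less.hyps X'(2) by blast
  next
    case False
    then show ?thesis using less.prems by (intro exI[of _ X]) (auto simp: incomparable_def)
  qed
qed

text \<open>The position of an element is the number of elements below it. The unconditional pairs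
  put \<open>m t\<close> and \<open>M t\<close> between the ends of the pair, and the outside rules
  keep all values beyond them away from there.\<close>

lemma (in closed_order) realizable_if_total:
  assumes total: "\<And>a b. a \<le> n + 1 \<Longrightarrow> b \<le> n + 1 \<Longrightarrow> a = b \<or> (a, b) \<in> X \<or> (b, a) \<in> X"
  shows "realizable n m M d"
proof -
  define pos where "pos x = card {y. (y, x) \<in> X}" for x
  have fin: "finite {y. (y, x) \<in> X}" for x
    by (rule finite_subset[of _ "{..n+1}"]) (use in_range in auto)
  have less: "pos x < pos y" if "(x, y) \<in> X" for x y
    unfolding pos_def
    by (rule psubset_card_mono[OF fin]) (use that transitive[OF _ that] in_range in blast)
  have iff: "pos x < pos y \<longleftrightarrow> (x, y) \<in> X" if "x \<le> n + 1" "y \<le> n + 1" for x y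
    using total[OF that] less[of x y] less[of y x] by auto
  have le_iff: "pos x \<le> pos y \<longleftrightarrow> x = y \<or> (x, y) \<in> X" if "x \<le> n + 1" "y \<le> n + 1" for x y
    using total[OF that] less[of x y] less[of y x] asym[of x y] by auto
  have inj: "inj_on pos {0..n+1}"
  proof (rule inj_onI)
    fix x y assume "x \<in> {0..n+1}" "y \<in> {0..n+1}" "pos x = pos y"
    then show "x = y" using total[of x y] less[of x y] less[of y x] by auto
  qed
  have "pos x \<le> n + 1" if "x \<le> n + 1" for x
  proof -
    have "{y. (y, x) \<in> X} \<subseteq> {..n+1} - {x}" using in_range by blast
    then have "pos x \<le> card ({..n+1} - {x})" unfolding pos_def by (intro card_mono) auto
    then show ?thesis using that by simp
  qed
  then have "pos ` {0..n+1} \<subseteq> {0..n+1}" by (simp add: image_subset_iff)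
  then have bij: "bij_betw pos {0..n+1} {0..n+1}"
    using inj by (simp add: bij_betw_def endo_inj_surj)
  have "(y, 0) \<notin> X" for y using zero_less[of y] asym in_range by blast
  then have "{y. (y, 0) \<in> X} = {}" by blast
  then have pos0: "pos 0 = 0" unfolding pos_def by (metis card.empty)
  have "{y. (y, n + 1) \<in> X} = {..n}" using less_top in_range by force
  then have "pos (n + 1) = n + 1" by (simp add: pos_def)
  with bij pos0 have "is_perm_pos n pos" by (simp add: is_perm_pos_def)
  moreover have "has_profile n pos m M d"
    unfolding has_profile_def
  proof (intro allI impI)
    fix t assume t: "t \<le> n"
    have p: "m t \<le> t" "t + 1 \<le> M t" "M t \<le> n + 1" using profile t by (auto simp: is_profile_def)
    have u: "unconditional n m M d 0 t \<subseteq> X" using unconditional_subset[of 0 t] t by simp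
    let ?l = "left_end d t" and ?r = "right_end d t"
    have lr: "?l \<le> n + 1" "?r \<le> n + 1" using t by (auto simp: left_end_def right_end_def)
    have lm: "?l = m t \<or> (?l, m t) \<in> X" "m t = ?r \<or> (m t, ?r) \<in> X"
      "?l = M t \<or> (?l, M t) \<in> X" "M t = ?r \<or> (M t, ?r) \<in> X"
      using u unfolding unconditional_def by auto
    \<comment> \<open>No rule relates the two ends directly. Their order, hence the direction
      \<open>d t\<close>, is composed through \<open>m t\<close>, which differs from at least one
      end.\<close>
    have "?l \<noteq> ?r" by (auto simp: left_end_def right_end_def)
    then have "(?l, ?r) \<in> X" using lm(1,2) transitive by metis
    then have "pos ?l < pos ?r" by (rule less)
    then have d: "d t \<longleftrightarrow> pos t < pos (t + 1)"
      and minmax: "min (pos t) (pos (t + 1)) = pos ?l" "max (pos t) (pos (t + 1)) = pos ?r"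
      by (auto simp: left_end_def right_end_def split: if_splits)
    have mem: "m t \<in> between_set n pos t" "M t \<in> between_set n pos t"
      using lm p t lr le_iff[of ?l "m t"] le_iff[of "m t" ?r] le_iff[of ?l "M t"] le_iff[of "M t" ?r]
      by (simp_all add: between_set_def minmax[simplified])
    have range: "m t \<le> x \<and> x \<le> M t" if "x \<in> between_set n pos t" for x
    proof (rule ccontr)
      assume "\<not> ?thesis"
      then have o: "outside m M x t" by (auto simp: outside_def)
      have x: "x \<le> n + 1" "?l = x \<or> (?l, x) \<in> X" "x = ?r \<or> (x, ?r) \<in> X"
        using that lr le_iff[of ?l x] le_iff[of x ?r] by (simp_all add: between_set_def minmax[simplified])
      have "x \<noteq> t" "x \<noteq> t + 1" using o p by (auto simp: outside_def)
      \<comment> \<open>Above one end and below the other, \<open>x\<close> would by the outside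
        rules be both above and below \<open>t\<close>.\<close>
      then have "(?l, x) \<in> X" "(x, ?r) \<in> X" using x by (auto simp: left_end_def right_end_def split: if_splits)
      then show False
        using outside_left[OF o t] outside_right[OF o t] asym
        by (auto simp: left_end_def right_end_def split: if_splits)
    qed
    show "Min (between_set n pos t) = m t \<and> Max (between_set n pos t) = M t \<and> (d t \<longleftrightarrow> pos t < pos (t + 1))"
      using d mem range finite_between_set by (auto intro!: Min_eqI Max_eqI)
  qed
  ultimately show ?thesis by (auto simp: realizable_def)
qed

lemma realizable_iff_irrefl_forced:
  assumes "is_profile n m M" "linear_profile n m M"
  shows "realizable n m M d \<longleftrightarrow> irrefl (forced n m M d)"
proof
  assume "irrefl (forced n m M d)"
  then have "closed_order n m M d (forced n m M d)"
    using assms closed_rel_forced forced_square by (simp add: closed_order_def)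
  from total_extension[OF this assms(2)] obtain Y where
    "closed_order n m M d Y" "\<forall>a\<le>n+1. \<forall>b\<le>n+1. a = b \<or> (a, b) \<in> Y \<or> (b, a) \<in> Y" by blast
  then show "realizable n m M d" using closed_order.realizable_if_total by blast
qed (rule realizable_imp_irrefl_forced)

section \<open>Structured programs on the register machine\<close>

fun basic :: "instr \<Rightarrow> bool" where
  "basic (Jz r l) = False"
| "basic (Jmp l) = False"
| "basic Halt = False"
| "basic _ = True"

fun run :: "instr list \<Rightarrow> (nat \<Rightarrow> nat) \<Rightarrow> nat \<Rightarrow> nat" where
  "run [] R = R"
| "run (i # is) R = run is (snd (exec i (0, R)))"

lemma run_append: "run (xs @ ys) R = run ys (run xs R)"
  by (induction xs arbitrary: R) auto

text \<open>Since jumps are absolute, a piece of code is a function of its start address.\<close>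
type_synonym code = "nat \<Rightarrow> instr list"

definition block :: "instr list \<Rightarrow> code" where
  "block is = (\<lambda>p. is)"

definition seq :: "code \<Rightarrow> code \<Rightarrow> code" where
  "seq c1 c2 = (\<lambda>p. c1 p @ c2 (p + length (c1 p)))"

text \<open>Inside the body the counter runs from its initial value minus one down to zero; register 3 is
  overwritten with the constant 1.\<close>
definition loop :: "nat \<Rightarrow> code \<Rightarrow> code" where
  "loop r c = (\<lambda>p. [Jz r (p + 4 + length (c (p + 3))), Const 3 1, Sub r r 3] @ c (p + 3) @ [Jmp p])"

text \<open>Total correctness with a time bound. The number of steps and the final registers are
  fixed before \<open>pre\<close> and \<open>post\<close>, so code behaves identically wherever it
  is placed, and control leaves it just behind its last instruction.\<close>

definition triple ::
  "((nat \<Rightarrow> nat) \<Rightarrow> bool) \<Rightarrow> code \<Rightarrow> nat \<Rightarrow> ((nat \<Rightarrow> nat) \<Rightarrow> bool) \<Rightarrow> bool" where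
  "triple P c T Q \<longleftrightarrow>
     (\<forall>R. P R \<longrightarrow> (\<exists>s\<le>T. \<exists>R'. Q R' \<and>
        (\<forall>pre post. (step (pre @ c (length pre) @ post) ^^ s) (length pre, R)
                    = (length pre + length (c (length pre)), R'))))"

lemma step_instr:
  assumes "p ! pc = i" "pc < length p" "i \<noteq> Halt"
  shows "step p (pc, R) = exec i (pc, R)"
  using assms by (simp add: step_def halted_def)

lemma exec_basic: "basic i \<Longrightarrow> exec i (pc, R) = (pc + 1, snd (exec i (0, R)))"
  by (cases i) auto

text \<open>Induction with \<open>pre\<close> generalised: each executed instruction migrates into
  the prefix.\<close>

lemma steps_block:
  assumes "\<forall>i\<in>set is. basic i"
  shows "(step (pre @ is @ post) ^^ length is) (length pre, R) = (length pre + length is, run is R)"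
  using assms
proof (induction "is" arbitrary: pre R)
  case (Cons i "is")
  have "step (pre @ (i # is) @ post) (length pre, R) = (length (pre @ [i]), snd (exec i (0, R)))"
    using Cons.prems exec_basic[of i "length pre" R] by (subst step_instr[where i = i]) auto
  then show ?case
    using Cons.IH[of "pre @ [i]"] Cons.prems by (simp del: funpow.simps add: funpow_Suc_right)
qed simp

lemma triple_block:
  assumes "\<forall>i\<in>set is. basic i" "\<And>R. P R \<Longrightarrow> Q (run is R)"
  shows "triple P (block is) (length is) Q"
  unfolding triple_def block_def
proof (intro allI impI)
  fix R assume "P R"
  then show "\<exists>s\<le>length is. \<exists>R'. Q R' \<and> (\<forall>pre post. (step (pre @ is @ post) ^^ s) (length pre, R) = (length pre + length is, R'))"
    using assms(2) steps_block[OF assms(1)] by (intro exI[of _ "length is"]) auto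
qed

lemma triple_conseq:
  assumes "triple P c T Q" "\<And>R. P' R \<Longrightarrow> P R" "\<And>R. Q R \<Longrightarrow> Q' R" "T \<le> T'"
  shows "triple P' c T' Q'"
  unfolding triple_def
proof (intro allI impI)
  fix R assume "P' R"
  then obtain s R' where "s \<le> T" "Q R'"
    "\<forall>pre post. (step (pre @ c (length pre) @ post) ^^ s) (length pre, R)
       = (length pre + length (c (length pre)), R')"
    using assms(1,2) unfolding triple_def by blast
  then show "\<exists>s\<le>T'. \<exists>R'. Q' R' \<and>
        (\<forall>pre post. (step (pre @ c (length pre) @ post) ^^ s) (length pre, R)
                    = (length pre + length (c (length pre)), R'))"
    using assms(3,4) order_trans by blast
qed

lemma triple_seq:
  assumes "triple P c1 T1 Q" "triple Q c2 T2 S"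
  shows "triple P (seq c1 c2) (T1 + T2) S"
  unfolding triple_def
proof (intro allI impI)
  fix R assume "P R"
  then obtain s1 R1 where 1: "s1 \<le> T1" "Q R1"
    "\<And>pre post. (step (pre @ c1 (length pre) @ post) ^^ s1) (length pre, R)
       = (length pre + length (c1 (length pre)), R1)"
    using assms(1) unfolding triple_def by blast
  obtain s2 R2 where 2: "s2 \<le> T2" "S R2"
    "\<And>pre post. (step (pre @ c2 (length pre) @ post) ^^ s2) (length pre, R1)
       = (length pre + length (c2 (length pre)), R2)"
    using assms(2) 1(2) unfolding triple_def by blast
  have "(step (pre @ seq c1 c2 (length pre) @ post) ^^ (s2 + s1)) (length pre, R)
       = (length pre + length (seq c1 c2 (length pre)), R2)" for pre post
    using 1(3)[of pre "c2 (length pre + length (c1 (length pre))) @ post"]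
      2(3)[of "pre @ c1 (length pre)" post]
    by (simp add: funpow_add seq_def)
  then show "\<exists>s\<le>T1 + T2. \<exists>R'. S R' \<and>
        (\<forall>pre post. (step (pre @ seq c1 c2 (length pre) @ post) ^^ s) (length pre, R)
                    = (length pre + length (seq c1 c2 (length pre)), R'))"
    using 1 2 by (intro exI[of _ "s2 + s1"]) auto
qed

text \<open>The counter is decremented before the body, so the body takes \<open>I (Suc k)\<close>
  to \<open>I k\<close> while the counter shows \<open>k\<close>. Each round costs 4 steps of
  overhead (test, constant, decrement, jump back), and the final test costs 1. The frame condition
  says that the loop's own writes do not disturb \<open>I\<close>.\<close>

lemma triple_loop:
  assumes body: "\<And>k. k < K \<Longrightarrow> triple (\<lambda>R. R r = k \<and> R 3 = 1 \<and> I (Suc k) R) c T (\<lambda>R. R r = k \<and> I k R)"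
    and frame: "\<And>k j R. I k R \<Longrightarrow> I k (R(3 := 1, r := j))"
    and r: "r \<noteq> 3"
  shows "triple (\<lambda>R. R r = K \<and> I K R) (loop r c) (K * (T + 4) + 1) (I 0)"
proof -
  have "k \<le> K \<Longrightarrow> R r = k \<Longrightarrow> I k R \<Longrightarrow>
    \<exists>s\<le>k * (T + 4) + 1. \<exists>R'. I 0 R' \<and>
      (\<forall>pre post. (step (pre @ loop r c (length pre) @ post) ^^ s) (length pre, R)
         = (length pre + length (loop r c (length pre)), R'))" for k R
  proof (induction k arbitrary: R)
    case 0
    have "step (pre @ loop r c (length pre) @ post) (length pre, R)
         = (length pre + length (loop r c (length pre)), R)" for pre post
      using 0 by (subst step_instr[where i = "Jz r (length pre + 4 + length (c (length pre + 3)))"])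
        (auto simp: loop_def nth_append)
    then show ?case using 0 by (intro exI[of _ 1]) auto
  next
    case (Suc k)
    let ?R = "R(3 := 1, r := k)"
    have "I (Suc k) ?R" using frame Suc.prems by blast
    then obtain s R1 where s: "s \<le> T" "R1 r = k" "I k R1"
      "\<And>pre post. (step (pre @ c (length pre) @ post) ^^ s) (length pre, ?R)
         = (length pre + length (c (length pre)), R1)"
      using body[of k] Suc.prems(1) r unfolding triple_def by (metis Suc_le_eq fun_upd_apply)
    then obtain s' R' where s': "s' \<le> k * (T + 4) + 1" "I 0 R'"
      "\<And>pre post. (step (pre @ loop r c (length pre) @ post) ^^ s') (length pre, R1)
         = (length pre + length (loop r c (length pre)), R')"
      using Suc.IH[of R1] Suc.prems by auto
    have "(step (pre @ loop r c (length pre) @ post) ^^ (s' + (1 + (s + 3)))) (length pre, R)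
         = (length pre + length (loop r c (length pre)), R')" for pre post
    proof -
      let ?c = "c (length pre + 3)"
      let ?h = "[Jz r (length pre + 4 + length ?c), Const 3 1, Sub r r 3]"
      let ?p = "pre @ loop r c (length pre) @ post"
      have p: "?p = pre @ ?h @ ?c @ Jmp (length pre) # post" by (simp add: loop_def)
      have 1: "step ?p (length pre, R) = (length pre + 1, R)"
        unfolding p using Suc.prems by (subst step_instr[where i = "Jz r (length pre + 4 + length ?c)"]) auto
      have 2: "step ?p (length pre + 1, R) = (length pre + 2, R(3 := 1))"
        unfolding p by (subst step_instr[where i = "Const 3 1"]) (auto simp: nth_append)
      have 3: "step ?p (length pre + 2, R(3 := 1)) = (length pre + 3, ?R)"
        unfolding p using Suc.prems r
        by (subst step_instr[where i = "Sub r r 3"]) (auto simp: nth_append)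
      have head: "(step ?p ^^ 3) (length pre, R) = (length pre + 3, ?R)"
        using 1 2 3 by (simp add: numeral_3_eq_3)
      have bdy: "(step ?p ^^ s) (length pre + 3, ?R) = (length pre + 3 + length ?c, R1)"
        using s(4)[of "pre @ ?h" "Jmp (length pre) # post"] unfolding p
        by (simp add: numeral_3_eq_3)
      have jmp: "step ?p (length pre + 3 + length ?c, R1) = (length pre, R1)"
        unfolding p
        by (subst step_instr[where i = "Jmp (length pre)"]) (auto simp: nth_append numeral_3_eq_3)
      show ?thesis
        unfolding funpow_add comp_apply head bdy using jmp s'(3) by simp
    qed
    then show ?case
      using s(1) s'(1,2) by (intro exI[of _ "s' + (1 + (s + 3))"]) auto
  qed
  then show ?thesis unfolding triple_def by blast
qed

text \<open>With empty surroundings, the end of the code is the end of the program, which counts as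
  halted.\<close>

lemma triple_halts_within:
  assumes "triple P c T (\<lambda>R. R 0 = out)" "P R"
  shows "\<exists>s\<le>T. halts_within (c 0) R s out"
proof -
  obtain s R' where s: "s \<le> T" "R' 0 = out"
    "\<And>pre post. (step (pre @ c (length pre) @ post) ^^ s) (length pre, R)
         = (length pre + length (c (length pre)), R')"
    using assms unfolding triple_def by blast
  then show ?thesis
    using s(3)[of "[]" "[]"] by (intro exI[of _ s]) (simp add: halts_within_def halted_def)
qed

lemma triple_ex:
  assumes "\<And>x. triple (P x) c T Q"
  shows "triple (\<lambda>R. \<exists>x. P x R) c T Q"
  using assms unfolding triple_def by blast

section \<open>The decision program\<close>

text \<open>The input is copied to the registers \<open>64 n - 3 + i\<close>, the entry \<open>(a, b)\<close> of the relation lives in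
  register \<open>row a + b\<close>, and register \<open>128 n + a\<close> contains the row address \<open>row a\<close>; an entry counts as set
  if it is nonzero.  Register 0 holds \<open>n\<close>, 1 holds 0, 3 holds 1, 4 and 5 hold the base addresses of the
  row table and of the input, 6 and 7 hold \<open>n + 1\<close> and \<open>n + 2\<close>, and 8 to 12 are loop counters.
  The last three of these are the \<open>a\<close>, \<open>t\<close>, \<open>c\<close> of the rules.\<close>

datatype mop = Arith instr | Both nat nat nat | Test nat nat nat | Mark nat nat nat | Fetch

text \<open>Subtraction is truncated, so \<open>1 - (1 - v)\<close> is the truth value of
  \<open>v \<noteq> 0\<close>; this replaces branching in \<open>Both\<close> and
  \<open>Test\<close>. \<open>Mark\<close> adds to an entry and therefore never clears one.
  Registers 24 and 25 are scratch.\<close>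

fun expand :: "mop \<Rightarrow> instr list" where
  "expand (Arith i) = [i]"
| "expand (Both r x y) = [Sub 24 3 x, Sub 24 3 24, Sub 25 3 y, Sub r 24 25]"
| "expand (Test r x y) = [Add 24 4 x, Load 24 24, Add 24 24 y, Load r 24, Sub r 3 r, Sub r 3 r]"
| "expand (Mark x y v) = [Add 24 4 x, Load 24 24, Add 24 24 y, Load 25 24, Add 25 25 v, Store 24 25]"
| "expand Fetch = [Add 24 11 11, Add 24 24 11, Add 24 24 5, Load 14 24, Add 24 24 3, Load 15 24,
                   Add 24 24 3, Load 16 24]"

text \<open>The two truncated differences sum to the distance of \<open>x\<close> and
  \<open>y\<close>. Adding this to the entry does nothing when they are equal, which realises the
  side condition of \<open>unconditional\<close> without a jump.\<close>

definition mark_unequal :: "nat \<Rightarrow> nat \<Rightarrow> mop list" where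
  "mark_unequal x y = [Arith (Sub 2 x y), Arith (Sub 13 y x), Arith (Add 2 2 13), Mark x y 2]"

text \<open>With the direction bit in register 16, \<open>1 - d + t\<close> is the left end
  (register 17) and \<open>t + d\<close> the right end (register 18).\<close>

definition mark_unconditional :: "mop list" where
  "mark_unconditional =
     [Fetch, Arith (Sub 17 3 16), Arith (Add 17 17 11), Arith (Add 18 11 16)]
     @ mark_unequal 1 10 @ mark_unequal 10 6
     @ mark_unequal 17 14 @ mark_unequal 14 18 @ mark_unequal 17 15 @ mark_unequal 15 18"

definition mark_transitive :: "mop list" where
  "mark_transitive = [Test 13 10 11, Test 14 11 12, Both 13 13 14, Mark 10 12 13]"

text \<open>The sum of the truncated differences \<open>m t - a\<close> and \<open>a - M t\<close>
  is nonzero exactly for \<open>a\<close> outside the interval. All tests precede the marks.\<close>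

definition mark_outside :: "mop list" where
  "mark_outside =
     [Fetch, Arith (Sub 14 14 10), Arith (Sub 15 10 15), Arith (Add 14 14 15), Arith (Add 13 11 3),
      Test 15 10 11, Test 16 10 13, Arith (Add 15 15 16), Both 15 15 14,
      Test 16 11 10, Test 17 13 10, Arith (Add 16 16 17), Both 16 16 14,
      Mark 10 11 15, Mark 10 13 15, Mark 11 10 16, Mark 13 10 16]"

definition rule_block :: code where
  "rule_block = block (concat (map expand (mark_unconditional @ mark_transitive @ mark_outside)))"

text \<open>\<open>Add r x 1\<close> copies register \<open>x\<close>, because register 1 holds
  0.\<close>

definition pass :: code where
  "pass =
     seq (block [Add 10 7 1]) (loop 10 (
     seq (block [Add 11 6 1]) (loop 11 (
     seq (block [Add 12 7 1]) (loop 12 rule_block)))))"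

definition saturate :: code where
  "saturate = seq (block [Add 8 7 1]) (loop 8 (seq (block [Add 9 7 1]) (loop 9 pass)))"

text \<open>Initially only register 1 is free: it contains \<open>m 0 = 0\<close>.\<close>
definition relocate :: code where
  "relocate =
     seq (block [Add 1 1 0, Add 1 1 1, Add 1 1 1, Add 1 1 1, Add 1 1 1, Add 1 1 1, Add 1 1 1,
                 Store 1 3, Const 3 1, Sub 1 1 3, Store 1 2, Add 1 1 3, Add 1 1 3, Store 1 4,
                 Add 1 1 3, Store 1 5, Add 5 0 0, Add 5 5 0, Const 2 5])
         (loop 5 (block [Add 1 1 3, Add 2 2 3, Load 4 2, Store 1 4]))"

text \<open>Base addresses arise by doubling, as there is no multiplication: \<open>64 * n\<close>
  after five doublings of \<open>2 * n\<close>, then \<open>128 * n\<close> for the row table and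
  \<open>256 * n\<close> for the first row.\<close>

definition build_rows :: code where
  "build_rows =
     seq (block [Const 1 0, Add 4 0 0, Add 4 4 4, Add 4 4 4, Add 4 4 4, Add 4 4 4, Add 4 4 4,
                 Const 3 1, Sub 5 4 3, Sub 5 5 3, Add 4 4 4, Add 9 4 4, Add 6 0 3, Add 7 6 3,
                 Add 8 7 1])
         (loop 8 (block [Add 10 4 8, Store 10 9, Add 9 9 7]))"

definition answer :: code where
  "answer =
     seq (block [Const 13 0, Add 10 7 1])
    (seq (loop 10 (block (concat (map expand [Test 14 10 10, Arith (Add 13 13 14)]))))
         (block [Const 3 1, Sub 0 3 13]))"

definition decide :: code where
  "decide = seq relocate (seq build_rows (seq saturate answer))"

definition rule_time :: nat where
  "rule_time = length (concat (map expand (mark_unconditional @ mark_transitive @ mark_outside)))"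

definition relocate_time :: "nat \<Rightarrow> nat" where
  "relocate_time n = 19 + (3 * n * (4 + 4) + 1)"

definition build_rows_time :: "nat \<Rightarrow> nat" where
  "build_rows_time n = 15 + ((n + 2) * (3 + 4) + 1)"

definition pass_time :: "nat \<Rightarrow> nat" where
  "pass_time n = 1 + ((n + 2) * ((1 + ((n + 1) * ((1 + ((n + 2) * (rule_time + 4) + 1)) + 4) + 1)) + 4) + 1)"

definition saturate_time :: "nat \<Rightarrow> nat" where
  "saturate_time n = 1 + ((n + 2) * ((1 + ((n + 2) * (pass_time n + 4) + 1)) + 4) + 1)"

definition answer_time :: "nat \<Rightarrow> nat" where
  "answer_time n = 2 + (((n + 2) * (7 + 4) + 1) + 2)"

definition decide_time :: "nat \<Rightarrow> nat" where
  "decide_time n = relocate_time n + (build_rows_time n + (saturate_time n + answer_time n))"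

section \<open>Memory layout and simulation of the abstract operations\<close>

locale machine_input =
  fixes n :: nat and m M :: "nat \<Rightarrow> nat" and d :: "nat \<Rightarrow> bool"
  assumes n_pos: "n \<ge> 1" and profile: "is_profile n m M"
begin

text \<open>Rows are stored in reverse order: the loop building them counts \<open>a\<close> down
  while the next free address grows.\<close>

definition row :: "nat \<Rightarrow> nat" where
  "row a = 256 * n + (n + 1 - a) * (n + 2)"

definition input_at :: "(nat \<Rightarrow> nat) \<Rightarrow> bool" where
  "input_at R \<longleftrightarrow> (\<forall>t\<le>n. R (64 * n - 2 + 3 * t) = m t \<and> R (64 * n - 1 + 3 * t) = M t
                         \<and> R (64 * n + 3 * t) = of_bool (d t))"

text \<open>Input copy, row table and relation start at \<open>64 * n - 2\<close>,
  \<open>128 * n\<close> and \<open>256 * n\<close>. For \<open>n \<ge> 1\<close> these areas are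
  disjoint and lie above register 31, so working registers can change freely.\<close>

definition mem :: "(nat \<times> nat) set \<Rightarrow> (nat \<Rightarrow> nat) \<Rightarrow> bool" where
  "mem X R \<longleftrightarrow> input_at R \<and> (\<forall>a\<le>n+1. R (128 * n + a) = row a) \<and>
     (\<forall>a\<le>n+1. \<forall>b\<le>n+1. R (row a + b) \<noteq> 0 \<longleftrightarrow> (a, b) \<in> X)"

lemma row_inj:
  assumes "a \<le> n + 1" "b \<le> n + 1" "a' \<le> n + 1" "b' \<le> n + 1"
  shows "row a + b = row a' + b' \<longleftrightarrow> a = a' \<and> b = b'"
proof
  assume "row a + b = row a' + b'"
  then have eq: "(n + 1 - a) * (n + 2) + b = (n + 1 - a') * (n + 2) + b'" by (simp add: row_def)
  have div: "(k * N + y) div N = k" if "y < N" for k N y :: nat using that by simp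
  have "((n + 1 - a) * (n + 2) + b) div (n + 2) = n + 1 - a"
    "((n + 1 - a') * (n + 2) + b') div (n + 2) = n + 1 - a'"
    using div[of b "n + 2"] div[of b' "n + 2"] assms by (simp_all del: mult_Suc_right add_2_eq_Suc')
  then have "n + 1 - a = n + 1 - a'" using eq by metis
  then show "a = a' \<and> b = b'" using eq assms by auto
qed simp

lemma mem_low [simp]: "r < 32 \<Longrightarrow> mem X (R(r := v)) = mem X R"
proof -
  assume r: "r < 32"
  have "64 * n - 2 + 3 * t \<noteq> r" "64 * n - 1 + 3 * t \<noteq> r" "64 * n + 3 * t \<noteq> r"
    "128 * n + t \<noteq> r" "row t + b \<noteq> r" for t b
    using r n_pos by (auto simp: row_def)
  then show ?thesis by (simp add: mem_def input_at_def)
qed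

lemma mem_mark:
  assumes "mem X R" "a \<le> n + 1" "b \<le> n + 1"
  shows "mem (if v \<noteq> 0 then insert (a, b) X else X) (R(row a + b := R (row a + b) + v))"
proof -
  have "64 * n - 2 + 3 * t \<noteq> row a + b" "64 * n - 1 + 3 * t \<noteq> row a + b" "64 * n + 3 * t \<noteq> row a + b"
    if "t \<le> n" for t using that n_pos by (auto simp: row_def)
  moreover have "128 * n + t \<noteq> row a + b" if "t \<le> n + 1" for t using that n_pos by (auto simp: row_def)
  ultimately show ?thesis
    using assms unfolding mem_def input_at_def by (auto simp: row_inj)
qed

text \<open>Abstract semantics in which the relation is a set and addresses and scratch registers
  have disappeared. The rules are verified at this level, and \<open>rep_mval\<close> transfers the
  result to the machine.\<close>

fun mval :: "mop \<Rightarrow> (nat \<Rightarrow> nat) \<times> (nat \<times> nat) set \<Rightarrow> (nat \<Rightarrow> nat) \<times> (nat \<times> nat) set" where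
  "mval (Arith i) (R, X) = (snd (exec i (0, R)), X)"
| "mval (Both r x y) (R, X) = (R(r := of_bool (R x \<noteq> 0 \<and> R y \<noteq> 0)), X)"
| "mval (Test r x y) (R, X) = (R(r := of_bool ((R x, R y) \<in> X)), X)"
| "mval (Mark x y v) (R, X) = (R, if R v \<noteq> 0 then insert (R x, R y) X else X)"
| "mval Fetch (R, X) = (R(14 := m (R 11), 15 := M (R 11), 16 := of_bool (d (R 11))), X)"

fun msafe :: "mop \<Rightarrow> (nat \<Rightarrow> nat) \<Rightarrow> bool" where
  "msafe (Arith (Const r k)) R \<longleftrightarrow> r < 24"
| "msafe (Arith (Add r x y)) R \<longleftrightarrow> r < 24 \<and> x < 24 \<and> y < 24"
| "msafe (Arith (Sub r x y)) R \<longleftrightarrow> r < 24 \<and> x < 24 \<and> y < 24"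
| "msafe (Arith i) R \<longleftrightarrow> False"
| "msafe (Both r x y) R \<longleftrightarrow> r < 24 \<and> x < 24 \<and> y < 24 \<and> R 3 = 1"
| "msafe (Test r x y) R \<longleftrightarrow> r < 24 \<and> r \<noteq> 3 \<and> x < 24 \<and> y < 24 \<and> R x \<le> n + 1 \<and> R y \<le> n + 1
     \<and> R 3 = 1 \<and> R 4 = 128 * n"
| "msafe (Mark x y v) R \<longleftrightarrow> x < 24 \<and> y < 24 \<and> v < 24 \<and> R x \<le> n + 1 \<and> R y \<le> n + 1 \<and> R 4 = 128 * n"
| "msafe Fetch R \<longleftrightarrow> R 11 \<le> n \<and> R 3 = 1 \<and> R 5 = 64 * n - 2"

fun mvals :: "mop list \<Rightarrow> (nat \<Rightarrow> nat) \<times> (nat \<times> nat) set \<Rightarrow> (nat \<Rightarrow> nat) \<times> (nat \<times> nat) set" where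
  "mvals [] s = s"
| "mvals (p # ps) s = mvals ps (mval p s)"

fun msafes :: "mop list \<Rightarrow> (nat \<Rightarrow> nat) \<times> (nat \<times> nat) set \<Rightarrow> bool" where
  "msafes [] s \<longleftrightarrow> True"
| "msafes (p # ps) s \<longleftrightarrow> msafe p (fst s) \<and> msafes ps (mval p s)"

definition rep :: "(nat \<Rightarrow> nat) \<times> (nat \<times> nat) set \<Rightarrow> (nat \<Rightarrow> nat) \<Rightarrow> bool" where
  "rep s R \<longleftrightarrow> (\<forall>r<24. R r = fst s r) \<and> mem (snd s) R"

lemma rep_mval:
  assumes rep: "rep s R" and safe: "msafe p (fst s)"
  shows "rep (mval p s) (run (expand p) R)"
proof -
  obtain \<sigma> X where s: "s = (\<sigma>, X)" by (cases s)
  have low: "\<And>r. r < 24 \<Longrightarrow> R r = \<sigma> r" and mem: "mem X R"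
    using rep s by (auto simp: rep_def)
  show ?thesis
  proof (cases p)
    case (Arith i)
    then show ?thesis using safe low mem s by (cases i) (auto simp: rep_def)
  next
    case (Both r x y)
    then show ?thesis using safe low mem s by (auto simp: rep_def)
  next
    case (Test r x y)
    have "R (128 * n + \<sigma> x) = row (\<sigma> x)" "R (row (\<sigma> x) + \<sigma> y) \<noteq> 0 \<longleftrightarrow> (\<sigma> x, \<sigma> y) \<in> X"
      using mem safe Test s by (auto simp: mem_def)
    moreover have "row (\<sigma> x) + \<sigma> y \<noteq> 24" "128 * n + \<sigma> x \<noteq> 24" using n_pos by (auto simp: row_def)
    ultimately show ?thesis using safe low mem s Test n_pos
      by (auto simp: rep_def)
  next
    case (Mark x y v)
    have "R (128 * n + \<sigma> x) = row (\<sigma> x)"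
      using mem safe Mark s by (auto simp: mem_def)
    moreover have "row (\<sigma> x) + \<sigma> y \<ge> 32" "128 * n + \<sigma> x \<ge> 32" using n_pos by (auto simp: row_def)
    moreover have "mem (if \<sigma> v \<noteq> 0 then insert (\<sigma> x, \<sigma> y) X else X)
      (R(24 := row (\<sigma> x) + \<sigma> y, 25 := R (row (\<sigma> x) + \<sigma> y) + \<sigma> v,
         row (\<sigma> x) + \<sigma> y := R (row (\<sigma> x) + \<sigma> y) + \<sigma> v))"
    proof -
      let ?R = "R(24 := row (\<sigma> x) + \<sigma> y, 25 := R (row (\<sigma> x) + \<sigma> y) + \<sigma> v)"
      have "?R (row (\<sigma> x) + \<sigma> y) = R (row (\<sigma> x) + \<sigma> y)" using n_pos by (auto simp: row_def)
      moreover have "mem X ?R" using mem by simp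
      ultimately show ?thesis using mem_mark[of X ?R "\<sigma> x" "\<sigma> y" "\<sigma> v"] safe Mark s by simp
    qed
    ultimately show ?thesis using safe low s Mark
      by (simp add: rep_def)
  next
    case Fetch
    define q where "q = 64 * n - 2 + 3 * \<sigma> 11"
    have q: "\<sigma> 11 + \<sigma> 11 + \<sigma> 11 + (64 * n - 2) = q" "32 \<le> q"
      "64 * n - 1 + 3 * \<sigma> 11 = q + 1" "64 * n + 3 * \<sigma> 11 = q + 2" using n_pos by (auto simp: q_def)
    have "R q = m (\<sigma> 11)" "R (64 * n - 1 + 3 * \<sigma> 11) = M (\<sigma> 11)"
      "R (64 * n + 3 * \<sigma> 11) = of_bool (d (\<sigma> 11))"
      using mem safe Fetch s unfolding q_def by (auto simp: mem_def input_at_def)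
    note this[unfolded q(3,4)]
    then show ?thesis using safe low mem s Fetch q(1,2)
      by (simp add: rep_def)
  qed
qed

lemma rep_mvals:
  "rep s R \<Longrightarrow> msafes ps s \<Longrightarrow> rep (mvals ps s) (run (concat (map expand ps)) R)"
  by (induction ps arbitrary: s R) (auto simp: run_append rep_mval)

lemma mvals_append: "mvals (ps @ qs) s = mvals qs (mvals ps s)"
  by (induction ps arbitrary: s) auto

lemma msafes_append: "msafes (ps @ qs) s \<longleftrightarrow> msafes ps s \<and> msafes qs (mvals ps s)"
  by (induction ps arbitrary: s) auto

definition fixed_regs :: "(nat \<Rightarrow> nat) \<Rightarrow> bool" where
  "fixed_regs R \<longleftrightarrow> R 0 = n \<and> R 1 = 0 \<and> R 4 = 128 * n \<and> R 5 = 64 * n - 2 \<and> R 6 = n + 1 \<and> R 7 = n + 2"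

definition ready :: "nat \<Rightarrow> nat \<Rightarrow> nat \<Rightarrow> (nat \<Rightarrow> nat) \<Rightarrow> bool" where
  "ready a t c R \<longleftrightarrow> fixed_regs R \<and> R 3 = 1 \<and> R 10 = a \<and> R 11 = t \<and> R 12 = c \<and> a \<le> n + 1 \<and> t \<le> n \<and> c \<le> n + 1"

lemma mark_unequal:
  assumes "ready a t c R" "x \<noteq> 2" "y \<noteq> 2" "x \<noteq> 13" "y \<noteq> 13" "x < 24" "y < 24" "R x \<le> n + 1" "R y \<le> n + 1"
  shows "msafes (mark_unequal x y) (R, X)"
    and "mvals (mark_unequal x y) (R, X) =
      (R(2 := (R x - R y) + (R y - R x), 13 := R y - R x), X \<union> {(u, v) \<in> {(R x, R y)}. u \<noteq> v})"
  using assms by (auto simp: mark_unequal_def ready_def fixed_regs_def fun_eq_iff)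


lemma ready_upd [simp]: "r = 2 \<or> 13 \<le> r \<Longrightarrow> ready a t c (R(r := v)) = ready a t c R"
  by (auto simp: ready_def fixed_regs_def)

text \<open>Register 2 is exempt because \<open>mark_unequal\<close> overwrites it.\<close>

definition agree :: "(nat \<Rightarrow> nat) \<Rightarrow> (nat \<Rightarrow> nat) \<Rightarrow> bool" where
  "agree R R' \<longleftrightarrow> (\<forall>r\<le>12. r \<noteq> 2 \<longrightarrow> R' r = R r)"

lemma ready_agree: "ready a t c R \<Longrightarrow> agree R R' \<Longrightarrow> ready a t c R'"
  by (auto simp: ready_def fixed_regs_def agree_def)

lemma mark_unconditional:
  assumes "ready a t c R"
  shows "msafes mark_unconditional (R, X) \<and>
    (\<exists>R'. mvals mark_unconditional (R, X) = (R', X \<union> unconditional n m M d a t) \<and> agree R R')"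
proof -
  have regs: "R 0 = n" "R 1 = 0" "R 3 = 1" "R 5 = 64 * n - 2" "R 6 = n + 1" "R 10 = a" "R 11 = t"
    "a \<le> n + 1" "t \<le> n" using assms by (auto simp: ready_def fixed_regs_def)
  have p: "m t \<le> n + 1" "M t \<le> n + 1" using profile \<open>t \<le> n\<close> by (auto simp: is_profile_def)
  note mu = mark_unequal[where a = a and t = t and c = c]
  show ?thesis
    using assms regs p
    by (cases "d t")
      (simp_all add: mark_unconditional_def mvals_append msafes_append mu agree_def
        unconditional_def left_end_def right_end_def, auto)
qed

lemma mark_transitive:
  assumes "ready a t c R"
  shows "msafes mark_transitive (R, X) \<and>
    (\<exists>R'. mvals mark_transitive (R, X) =
       (R', X \<union> (if (a, t) \<in> X \<and> (t, c) \<in> X then {(a, c)} else {})) \<and> agree R R')"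
proof -
  have regs: "R 3 = 1" "R 4 = 128 * n" "R 10 = a" "R 11 = t" "R 12 = c"
    "a \<le> n + 1" "t \<le> n + 1" "c \<le> n + 1" using assms by (auto simp: ready_def fixed_regs_def)
  then show ?thesis
    by (simp add: mark_transitive_def agree_def)
qed

lemma mark_outside:
  assumes "ready a t c R"
  shows "msafes mark_outside (R, X) \<and>
    (\<exists>R'. mvals mark_outside (R, X) =
       (R', X \<union> (if outside m M a t \<and> ((a, t) \<in> X \<or> (a, t + 1) \<in> X) then {(a, t), (a, t + 1)} else {})
              \<union> (if outside m M a t \<and> ((t, a) \<in> X \<or> (t + 1, a) \<in> X) then {(t, a), (t + 1, a)} else {}))
       \<and> agree R R')"
proof -
  have regs: "R 3 = 1" "R 4 = 128 * n" "R 5 = 64 * n - 2" "R 10 = a" "R 11 = t"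
    "a \<le> n + 1" "t \<le> n" "t \<le> n + 1" using assms by (auto simp: ready_def fixed_regs_def)
  then show ?thesis
    by (simp add: mark_outside_def agree_def outside_def not_le, auto)
qed

section \<open>Passes and saturation\<close>

lemma rep_self: "mem X R \<Longrightarrow> rep (R, X) R"
  by (simp add: rep_def)

text \<open>Marks are made in place and may enable further rules within the same pass, so the stored
  relation is not tracked exactly but only enclosed between \<open>Y\<close> and the
  closure.\<close>

definition enough :: "(nat \<times> nat) set \<Rightarrow> (nat \<Rightarrow> nat) \<Rightarrow> bool" where
  "enough Y R \<longleftrightarrow> fixed_regs R \<and> (\<exists>X. mem X R \<and> Y \<subseteq> X \<and> X \<subseteq> forced n m M d)"

lemma basic_expand: "msafe p R \<Longrightarrow> i \<in> set (expand p) \<Longrightarrow> basic i"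
  by (cases p) (auto elim: msafe.elims)

lemma basic_expand_list: "msafes ps s \<Longrightarrow> i \<in> set (concat (map expand ps)) \<Longrightarrow> basic i"
  by (induction ps s rule: msafes.induct) (auto dest: basic_expand)

text \<open>Later rules see the marks of earlier ones. The lower bound survives because every rule
  is monotone, the upper bound because \<open>forced\<close> is closed.\<close>

lemma triple_rule_block:
  assumes le: "a \<le> n + 1" "t \<le> n" "c \<le> n + 1"
  shows "triple (\<lambda>R. R 12 = c \<and> R 3 = 1 \<and> enough Y R \<and> R 8 = i \<and> R 9 = j \<and> R 10 = a \<and> R 11 = t)
           rule_block rule_time
         (\<lambda>R. R 12 = c \<and> enough (Y \<union> conseqs n m M d Y a t c) R \<and> R 8 = i \<and> R 9 = j \<and> R 10 = a \<and> R 11 = t)"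
    (is "triple ?P _ _ ?Q")
proof -
  let ?ps = "mark_unconditional @ mark_transitive @ mark_outside"
  have run: "msafes ?ps (R, X) \<and> (\<exists>R'. mvals ?ps (R, X) = (R', X') \<and> agree R R' \<and>
      X \<union> conseqs n m M d X a t c \<subseteq> X' \<and> (X \<subseteq> forced n m M d \<longrightarrow> X' \<subseteq> forced n m M d))"
    if ready: "ready a t c R" and X': "X' = snd (mvals ?ps (R, X))" for R X X'
  proof -
    obtain R1 where 1: "msafes mark_unconditional (R, X)" "agree R R1"
      "mvals mark_unconditional (R, X) = (R1, X \<union> unconditional n m M d a t)"
      using mark_unconditional[OF ready] by blast
    define U where "U = unconditional n m M d a t"
    define P where "P Y = (if (a, t) \<in> Y \<and> (t, c) \<in> Y then {(a, c)} else {})" for Y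
    define Q where "Q Y = (if outside m M a t \<and> ((a, t) \<in> Y \<or> (a, t + 1) \<in> Y)
      then {(a, t), (a, t + 1)} else {})" for Y
    define S where "S Y = (if outside m M a t \<and> ((t, a) \<in> Y \<or> (t + 1, a) \<in> Y)
      then {(t, a), (t + 1, a)} else {})" for Y
    have mono: "P Y \<subseteq> P Y'" "Q Y \<subseteq> Q Y'" "S Y \<subseteq> S Y'" if "Y \<subseteq> Y'" for Y Y'
      using that by (auto simp: P_def Q_def S_def)
    have conseqs: "conseqs n m M d Y a t c = U \<union> P Y \<union> Q Y \<union> S Y" for Y
      by (simp only: conseqs_def U_def P_def Q_def S_def)
    define X1 where "X1 = X \<union> U"
    define X2 where "X2 = X1 \<union> P X1"
    define X3 where "X3 = X2 \<union> Q X2 \<union> S X2"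
    obtain R2 where 2: "msafes mark_transitive (R1, X1)" "agree R1 R2"
      "mvals mark_transitive (R1, X1) = (R2, X2)"
      using mark_transitive[OF ready_agree[OF ready 1(2)], of X1] unfolding X2_def P_def by blast
    obtain R3 where 3: "msafes mark_outside (R2, X2)" "agree R2 R3"
      "mvals mark_outside (R2, X2) = (R3, X3)"
      using mark_outside[OF ready_agree[OF ready_agree[OF ready 1(2)] 2(2)], of X2] unfolding X3_def Q_def S_def by blast
    have fin: "mvals ?ps (R, X) = (R3, X3)" by (simp only: mvals_append 1(3)[folded U_def X1_def] 2(3) 3(3))
    have safe: "msafes ?ps (R, X)" using 1(1) 2(1) 3(1) by (simp only: msafes_append mvals_append 1(3)[folded U_def X1_def] 2(3))
    have agree: "agree R R3" using 1(2) 2(2) 3(2) by (auto simp: agree_def)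
    have X'3: "X' = X3" using X' fin by simp
    have low: "X \<union> conseqs n m M d X a t c \<subseteq> X3"
      using mono[of X X1] mono[of X1 X2] mono[of X X2] unfolding conseqs X1_def X2_def X3_def by blast
    have high: "X3 \<subseteq> forced n m M d" if "X \<subseteq> forced n m M d"
    proof -
      let ?Z = "forced n m M d"
      have Z: "U \<subseteq> ?Z" "P ?Z \<subseteq> ?Z" "Q ?Z \<subseteq> ?Z" "S ?Z \<subseteq> ?Z"
        using closed_relD[OF closed_rel_forced le, of m M d, unfolded conseqs] by blast+
      have "X1 \<subseteq> ?Z" using that Z unfolding X1_def by blast
      then have "X2 \<subseteq> ?Z" using mono[of X1 ?Z] Z unfolding X2_def by blast
      then show ?thesis using mono[of X2 ?Z] Z unfolding X3_def by blast
    qed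
    show ?thesis using safe agree fin X'3 low high by blast
  qed
  have "msafes ?ps (R, X)" if "ready a t c R" for R X using run[OF that refl] by blast
  \<comment> \<open>Safety in any one state shows that the code is free of jumps; this state is such
    a witness.\<close>
  moreover have "ready a t c ((\<lambda>_. 0)(0 := n, 3 := 1, 4 := 128 * n, 5 := 64 * n - 2, 6 := n + 1, 7 := n + 2, 10 := a, 11 := t, 12 := c))"
    using le by (simp add: ready_def fixed_regs_def)
  ultimately have basic: "\<forall>i\<in>set (concat (map expand ?ps)). basic i"
    using basic_expand_list by blast
  have "?Q (run (concat (map expand ?ps)) R)" if P: "?P R" for R
  proof -
    have ready: "ready a t c R" using P le by (auto simp: ready_def enough_def)
    obtain X where X: "mem X R" "Y \<subseteq> X" "X \<subseteq> forced n m M d" using P by (auto simp: enough_def)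
    obtain R' X' where r: "msafes ?ps (R, X)" "mvals ?ps (R, X) = (R', X')" "agree R R'"
      "X \<union> conseqs n m M d X a t c \<subseteq> X'" "X' \<subseteq> forced n m M d" using run[OF ready refl, of X] X(3) by blast
    have "rep (R', X') (run (concat (map expand ?ps)) R)"
      using rep_mvals[OF rep_self[OF X(1)] r(1)] r(2) by simp
    then have low: "\<And>r. r < 24 \<Longrightarrow> run (concat (map expand ?ps)) R r = R' r"
      and mem: "mem X' (run (concat (map expand ?ps)) R)" by (auto simp: rep_def)
    have "Y \<union> conseqs n m M d Y a t c \<subseteq> X'" using X(2) r(4) conseqs_mono[OF X(2)] by blast
    then show ?thesis
      using low mem r(3,5) P by (auto simp: enough_def fixed_regs_def agree_def)
  qed
  then show ?thesis unfolding rule_block_def rule_time_def by (rule triple_block[OF basic])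
qed

abbreviation Z :: "(nat \<times> nat) set" where "Z \<equiv> forced n m M d"

lemma fixed_regs_upd [simp]: "r \<notin> {0, 1, 4, 5, 6, 7} \<Longrightarrow> fixed_regs (R(r := v)) = fixed_regs R"
  by (auto simp: fixed_regs_def)

lemma enough_upd [simp]: "r < 32 \<Longrightarrow> r \<notin> {0, 1, 4, 5, 6, 7} \<Longrightarrow> enough Y (R(r := v)) = enough Y R"
  by (simp add: enough_def)

lemma enough_mono: "enough Y R \<Longrightarrow> Y' \<subseteq> Y \<Longrightarrow> enough Y' R"
  unfolding enough_def by blast

text \<open>\<open>G k\<close> does not depend on the relation reached so far. In a pass it stands
  for consequences of the relation at its start, which by monotonicity remain derivable from every
  larger \<open>Y'\<close>.\<close>

lemma triple_accumulate:
  assumes body: "\<And>k Y'. k < K \<Longrightarrow> Y \<subseteq> Y' \<Longrightarrow>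
      triple (\<lambda>R. R r = k \<and> R 3 = 1 \<and> enough Y' R \<and> F R) c T (\<lambda>R. R r = k \<and> enough (Y' \<union> G k) R \<and> F R)"
    and frame: "\<And>R j. F (R(3 := 1, r := j)) = F R" "\<And>R j. F (R(r := j)) = F R"
    and r: "r \<in> {8..12}" and K: "\<And>R. fixed_regs R \<Longrightarrow> R x = K"
  shows "triple (\<lambda>R. enough Y R \<and> F R) (seq (block [Add r x 1]) (loop r c)) (1 + (K * (T + 4) + 1))
           (\<lambda>R. enough (Y \<union> (\<Union>k<K. G k)) R \<and> F R)"
proof -
  define I where "I k R \<longleftrightarrow> enough (Y \<union> (\<Union>j\<in>{k..<K}. G j)) R \<and> F R" for k R
  have "triple (\<lambda>R. R r = K \<and> I K R) (loop r c) (K * (T + 4) + 1) (I 0)"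
  proof (rule triple_loop[where I = I])
    fix k assume k: "k < K"
    have "{k..<K} = insert k {Suc k..<K}" using k by auto
    then have eq: "Y \<union> (\<Union>j\<in>{k..<K}. G j) = (Y \<union> (\<Union>j\<in>{Suc k..<K}. G j)) \<union> G k" by auto
    show "triple (\<lambda>R. R r = k \<and> R 3 = 1 \<and> I (Suc k) R) c T (\<lambda>R. R r = k \<and> I k R)"
      unfolding I_def eq by (rule body[OF k]) blast
  qed (use r frame in \<open>auto simp: I_def\<close>)
  moreover have "triple (\<lambda>R. enough Y R \<and> F R) (block [Add r x 1]) (length [Add r x 1]) (\<lambda>R. R r = K \<and> I K R)"
  proof (rule triple_block)
    fix R assume R: "enough Y R \<and> F R"
    then have "R x = K" "R 1 = 0" using K[of R] by (auto simp: enough_def fixed_regs_def)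
    then show "run [Add r x 1] R r = K \<and> I K (run [Add r x 1] R)"
      using R r frame(2)[of R K] by (auto simp: I_def)
  qed simp
  ultimately have "triple (\<lambda>R. enough Y R \<and> F R) (seq (block [Add r x 1]) (loop r c))
      (length [Add r x 1] + (K * (T + 4) + 1)) (I 0)"
    by (rule triple_seq[rotated])
  then show ?thesis
    by (rule triple_conseq) (auto simp: I_def atLeast0LessThan)
qed

definition consequences :: "(nat \<times> nat) set \<Rightarrow> (nat \<times> nat) set" where
  "consequences Y = (\<Union>a<n+2. \<Union>t<n+1. \<Union>c<n+2. conseqs n m M d Y a t c)"

lemma closed_rel_iff_consequences: "closed_rel n m M d Y \<longleftrightarrow> consequences Y \<subseteq> Y"
proof -
  have "{..n+1} = {..<n+2}" "{..n} = {..<n+1}" by auto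
  then show ?thesis unfolding closed_rel_def consequences_def UN_subset_iff by (simp add: Ball_def less_Suc_eq_le)
qed

lemma triple_pass:
  "triple (\<lambda>R. enough Y R \<and> R 8 = i \<and> R 9 = j) pass (pass_time n)
     (\<lambda>R. enough (Y \<union> consequences Y) R \<and> R 8 = i \<and> R 9 = j)"
  unfolding pass_def pass_time_def consequences_def
proof (rule triple_accumulate)
  fix a Y1 assume a: "a < n + 2" and Y1: "Y \<subseteq> Y1"
  show "triple (\<lambda>R. R 10 = a \<and> R 3 = 1 \<and> enough Y1 R \<and> R 8 = i \<and> R 9 = j)
     (seq (block [Add 11 6 1]) (loop 11 (seq (block [Add 12 7 1]) (loop 12 rule_block))))
     (1 + ((n + 1) * ((1 + ((n + 2) * (rule_time + 4) + 1)) + 4) + 1))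
     (\<lambda>R. R 10 = a \<and> enough (Y1 \<union> (\<Union>t<n+1. \<Union>c<n+2. conseqs n m M d Y a t c)) R \<and> R 8 = i \<and> R 9 = j)"
  proof (rule triple_conseq[OF triple_accumulate[where F = "\<lambda>R. R 8 = i \<and> R 9 = j \<and> R 10 = a"]])
    fix t Y2 assume t: "t < n + 1" and Y2: "Y1 \<subseteq> Y2"
    show "triple (\<lambda>R. R 11 = t \<and> R 3 = 1 \<and> enough Y2 R \<and> R 8 = i \<and> R 9 = j \<and> R 10 = a)
       (seq (block [Add 12 7 1]) (loop 12 rule_block))
       (1 + ((n + 2) * (rule_time + 4) + 1))
       (\<lambda>R. R 11 = t \<and> enough (Y2 \<union> (\<Union>c<n+2. conseqs n m M d Y a t c)) R \<and> R 8 = i \<and> R 9 = j \<and> R 10 = a)"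
    proof (rule triple_conseq[OF triple_accumulate[where F = "\<lambda>R. R 8 = i \<and> R 9 = j \<and> R 10 = a \<and> R 11 = t"]])
      fix c Y3 assume c: "c < n + 2" and Y3: "Y2 \<subseteq> Y3"
      have "conseqs n m M d Y a t c \<subseteq> conseqs n m M d Y3 a t c"
        using Y1 Y2 Y3 by (intro conseqs_mono) blast
      then show "triple (\<lambda>R. R 12 = c \<and> R 3 = 1 \<and> enough Y3 R \<and> R 8 = i \<and> R 9 = j \<and> R 10 = a \<and> R 11 = t)
         rule_block rule_time
         (\<lambda>R. R 12 = c \<and> enough (Y3 \<union> conseqs n m M d Y a t c) R \<and> R 8 = i \<and> R 9 = j \<and> R 10 = a \<and> R 11 = t)"
        using a t c by (intro triple_conseq[OF triple_rule_block[of a t c Y3 i j]]) (auto elim: enough_mono)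
    qed (auto simp: fixed_regs_def)
  qed (auto simp: fixed_regs_def)
qed (auto simp: fixed_regs_def)

text \<open>Here \<open>q\<close> bounds the passes still to come: either the closure is reached, or
  the pairs present and the passes left together number at least the size of the square.\<close>

definition fuel :: "nat \<Rightarrow> (nat \<Rightarrow> nat) \<Rightarrow> bool" where
  "fuel q R \<longleftrightarrow> fixed_regs R \<and>
     (\<exists>X. mem X R \<and> X \<subseteq> Z \<and> (X = Z \<or> (n + 2) * (n + 2) \<le> card X + q))"

lemma fuel_upd [simp]: "r < 32 \<Longrightarrow> r \<notin> {0, 1, 4, 5, 6, 7} \<Longrightarrow> fuel q (R(r := v)) = fuel q R"
  by (simp add: fuel_def)

lemma finite_forced: "finite Z"
  by (rule finite_subset[OF forced_square[OF profile]]) simp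

text \<open>Until the relation is saturated, each pass adds at least one pair.\<close>
lemma triple_pass_fuel:
  "triple (\<lambda>R. fuel (Suc q) R \<and> R 8 = i \<and> R 9 = j) pass (pass_time n)
     (\<lambda>R. fuel q R \<and> R 8 = i \<and> R 9 = j)"
proof -
  have "triple (\<lambda>R. (X \<subseteq> Z \<and> (X = Z \<or> (n + 2) * (n + 2) \<le> card X + Suc q)) \<and> enough X R \<and> R 8 = i \<and> R 9 = j)
     pass (pass_time n) (\<lambda>R. fuel q R \<and> R 8 = i \<and> R 9 = j)" for X
  proof (cases "X \<subseteq> Z \<and> (X = Z \<or> (n + 2) * (n + 2) \<le> card X + Suc q)")
    case True
    have "fuel q R" if enough: "enough (X \<union> consequences X) R" for R
    proof -
      obtain X' where X': "mem X' R" "X \<union> consequences X \<subseteq> X'" "X' \<subseteq> Z"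
        using enough unfolding enough_def by blast
      have "X' = Z \<or> (n + 2) * (n + 2) \<le> card X' + q"
      proof (cases "X = Z")
        case False
        then have "\<not> closed_rel n m M d X" using True forced_least by blast
        then have "X \<subset> X'" using X'(2) closed_rel_iff_consequences by blast
        then have "card X < card X'" using X'(3) finite_forced finite_subset psubset_card_mono by metis
        then show ?thesis using True False by auto
      qed (use X' in auto)
      then show ?thesis using enough X' by (auto simp: enough_def fuel_def)
    qed
    then show ?thesis by (intro triple_conseq[OF triple_pass[of X i j]]) auto
  next
    case False
    then show ?thesis unfolding triple_def by blast
  qed
  then have "triple (\<lambda>R. \<exists>X. (X \<subseteq> Z \<and> (X = Z \<or> (n + 2) * (n + 2) \<le> card X + Suc q))
      \<and> enough X R \<and> R 8 = i \<and> R 9 = j) pass (pass_time n) (\<lambda>R. fuel q R \<and> R 8 = i \<and> R 9 = j)"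
    by (rule triple_ex)
  then show ?thesis
  proof (rule triple_conseq)
    fix R assume "fuel (Suc q) R \<and> R 8 = i \<and> R 9 = j"
    then show "\<exists>X. (X \<subseteq> Z \<and> (X = Z \<or> (n + 2) * (n + 2) \<le> card X + Suc q))
      \<and> enough X R \<and> R 8 = i \<and> R 9 = j"
      unfolding fuel_def enough_def by blast
  qed simp_all
qed

lemma triple_saturate: "triple (enough {}) saturate (saturate_time n) (\<lambda>R. fixed_regs R \<and> mem Z R)"
proof -
  let ?N = "n + 2"
  \<comment> \<open>With outer counter \<open>i\<close> and inner counter \<open>k\<close>,
    \<open>i * ?N + k\<close> passes remain; one inner loop uses up \<open>?N\<close> of
    them.\<close>
  have inner: "triple (\<lambda>R. R 8 = i \<and> R 3 = 1 \<and> fuel (Suc i * ?N) R)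
      (seq (block [Add 9 7 1]) (loop 9 pass)) (length [Add 9 7 1] + (?N * (pass_time n + 4) + 1))
      (\<lambda>R. R 8 = i \<and> fuel (i * ?N) R)" for i
  proof (rule triple_conseq[OF triple_seq])
    show "triple (\<lambda>R. R 9 = ?N \<and> (fuel (i * ?N + ?N) R \<and> R 8 = i)) (loop 9 pass)
        (?N * (pass_time n + 4) + 1) (\<lambda>R. fuel (i * ?N + 0) R \<and> R 8 = i)"
    proof (rule triple_loop[where I = "\<lambda>k R. fuel (i * ?N + k) R \<and> R 8 = i"])
      fix k
      show "triple (\<lambda>R. R 9 = k \<and> R 3 = 1 \<and> fuel (i * ?N + Suc k) R \<and> R 8 = i) pass (pass_time n)
          (\<lambda>R. R 9 = k \<and> fuel (i * ?N + k) R \<and> R 8 = i)"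
        by (rule triple_conseq[OF triple_pass_fuel[of "i * ?N + k" i k]]) auto
    qed auto
    show "triple (\<lambda>R. R 8 = i \<and> fuel (Suc i * ?N) R) (block [Add 9 7 1]) (length [Add 9 7 1])
        (\<lambda>R. R 9 = ?N \<and> fuel (i * ?N + ?N) R \<and> R 8 = i)"
      by (rule triple_block) (auto simp: fixed_regs_def fuel_def add.commute)
  qed auto
  have "triple (enough {}) saturate (length [Add 8 7 1] + (?N * ((length [Add 9 7 1] + (?N * (pass_time n + 4) + 1)) + 4) + 1))
      (\<lambda>R. fuel (0 * ?N) R)"
    unfolding saturate_def
  proof (rule triple_seq)
    show "triple (\<lambda>R. R 8 = ?N \<and> fuel (?N * ?N) R) (loop 8 (seq (block [Add 9 7 1]) (loop 9 pass)))
      (?N * ((length [Add 9 7 1] + (?N * (pass_time n + 4) + 1)) + 4) + 1) (\<lambda>R. fuel (0 * ?N) R)"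
      by (rule triple_loop[where I = "\<lambda>k R. fuel (k * ?N) R"]) (use inner in auto)
    show "triple (enough {}) (block [Add 8 7 1]) (length [Add 8 7 1]) (\<lambda>R. R 8 = ?N \<and> fuel (?N * ?N) R)"
      by (rule triple_block) (auto simp: fixed_regs_def fuel_def enough_def)
  qed
  then show ?thesis
  proof (rule triple_conseq)
    fix R assume "fuel (0 * ?N) R"
    then obtain X where X: "fixed_regs R" "mem X R" "X \<subseteq> Z" "X = Z \<or> ?N * ?N \<le> card X"
      by (auto simp: fuel_def)
    have sq: "Z \<subseteq> {..n+1} \<times> {..n+1}" "card ({..n+1} \<times> {..n+1}) = ?N * ?N"
      using forced_square[OF profile] by (auto simp: card_cartesian_product)
    \<comment> \<open>Without passes left, an unsaturated \<open>X\<close> would have as many pairs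
      as the square and hence be the square; but \<open>Z\<close> lies between the two.\<close>
    have "X = Z"
    proof (rule ccontr)
      assume "X \<noteq> Z"
      then have "X = {..n+1} \<times> {..n+1}"
        using X sq by (intro card_seteq) auto
      then show False using X(3) sq(1) \<open>X \<noteq> Z\<close> by blast
    qed
    then show "fixed_regs R \<and> mem Z R" using X by simp
  qed (auto simp: saturate_time_def)
qed

section \<open>Initialising the memory\<close>

lemma encode_table:
  assumes "t \<le> n"
  shows "encode n m M d (3 * t + 1) = m t" "encode n m M d (3 * t + 2) = M t"
    "encode n m M d (3 * t + 3) = of_bool (d t)"
proof -
  have "(3 * t + 1) div 3 = t" "(3 * t + 1) mod 3 = 1" "(3 * t + 2) div 3 = t" "(3 * t + 2) mod 3 = 2"
    by presburger+
  then show "encode n m M d (3 * t + 1) = m t" "encode n m M d (3 * t + 2) = M t"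
    "encode n m M d (3 * t + 3) = of_bool (d t)"
    using assms by (simp_all add: encode_def)
qed

lemma triple_relocate:
  "triple (\<lambda>R. R = encode n m M d) relocate (relocate_time n)
     (\<lambda>R. R 0 = n \<and> input_at R \<and> (\<forall>x\<ge>128 * n. R x = 0))"
proof -
  let ?E = "encode n m M d"
  have "m 0 = 0" using profile unfolding is_profile_def by (metis le_zero_eq zero_le)
  then have m0: "?E 1 = 0" using encode_table(1)[of 0] by simp
  have E0: "?E 0 = n" by (simp add: encode_def)
  have E_high: "?E x = 0" if "x > 3 * n + 3" for x using that by (simp add: encode_def)
  \<comment> \<open>Input register \<open>i\<close> moves to \<open>64 * n - 3 + i\<close>.
    Registers 1 and 2 hold the last target address and source index. The loop starts after index 5
    and makes \<open>3 * n\<close> rounds, so it also copies two zeros behind the input.\<close>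
  define I where "I k R \<longleftrightarrow> k \<le> 3 * n \<and> R 0 = n \<and> R 1 = 64 * n + 2 + (3 * n - k) \<and> R 2 = 5 + (3 * n - k) \<and>
     R (64 * n - 2) = 0 \<and> (\<forall>i\<in>{2..5 + (3 * n - k)}. R (64 * n - 3 + i) = ?E i) \<and>
     (\<forall>x\<ge>6. x < 64 * n - 2 \<or> x > 64 * n + 2 + (3 * n - k) \<longrightarrow> R x = ?E x)" for k R
  have loop: "triple (\<lambda>R. R 5 = 3 * n \<and> I (3 * n) R) (loop 5 (block [Add 1 1 3, Add 2 2 3, Load 4 2, Store 1 4]))
      (3 * n * (length [Add 1 1 3, Add 2 2 3, Load 4 2, Store 1 4] + 4) + 1) (I 0)"
  proof (rule triple_loop[where I = I])
    fix k assume k: "k < 3 * n"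
    define q where "q = 3 * n - Suc k"
    have q: "3 * n - k = Suc q" "q < 3 * n" using k by (auto simp: q_def)
    show "triple (\<lambda>R. R 5 = k \<and> R 3 = 1 \<and> I (Suc k) R) (block [Add 1 1 3, Add 2 2 3, Load 4 2, Store 1 4])
      (length [Add 1 1 3, Add 2 2 3, Load 4 2, Store 1 4]) (\<lambda>R. R 5 = k \<and> I k R)"
    proof (rule triple_block)
      fix R assume R: "R 5 = k \<and> R 3 = 1 \<and> I (Suc k) R"
      define R' where "R' = run [Add 1 1 3, Add 2 2 3, Load 4 2, Store 1 4] R"
      have r: "R 1 = 64 * n + 2 + q" "R 2 = 5 + q" "R 3 = 1" "R 0 = n" "R (64 * n - 2) = 0"
        and copied: "\<And>i. i \<in> {2..5 + q} \<Longrightarrow> R (64 * n - 3 + i) = ?E i"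
        and rest: "\<And>x. x \<ge> 6 \<Longrightarrow> x < 64 * n - 2 \<or> x > 64 * n + 2 + q \<Longrightarrow> R x = ?E x"
        using R unfolding I_def q_def by auto
      \<comment> \<open>The source is still intact: \<open>6 + q\<close> lies below the target
        area.\<close>
      have src: "R (6 + q) = ?E (6 + q)" using rest[of "6 + q"] q n_pos by auto
      have Req: "R' = R(1 := 64 * n + 3 + q, 2 := 6 + q, 4 := ?E (6 + q), 64 * n + 3 + q := ?E (6 + q))"
        using r src n_pos unfolding R'_def by (simp add: fun_upd_twist numeral_3_eq_3)
      have "R' (64 * n - 3 + i) = ?E i" if "i \<in> {2..6 + q}" for i
      proof (cases "i = 6 + q")
        case True then show ?thesis using n_pos by (simp add: Req)
      next
        case False
        then have "64 * n - 3 + i \<notin> {1, 2, 4, 64 * n + 3 + q}" "i \<in> {2..5 + q}" using that n_pos by auto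
        then show ?thesis using copied[of i] by (simp add: Req)
      qed
      moreover have "R' x = ?E x" if "x \<ge> 6" "x < 64 * n - 2 \<or> x > 64 * n + 3 + q" for x
        using that rest[of x] n_pos by (auto simp: Req)
      moreover have "64 * n - 2 \<notin> {1, 2, 4, 64 * n + 3 + q}" using n_pos by auto
      then have "R' (64 * n - 2) = 0" using r by (simp add: Req)
      moreover have "R' 0 = n" "R' 1 = 64 * n + 3 + q" "R' 2 = 6 + q" "R' 5 = k"
        using r R n_pos by (simp_all add: Req)
      ultimately show "run [Add 1 1 3, Add 2 2 3, Load 4 2, Store 1 4] R 5 = k
          \<and> I k (run [Add 1 1 3, Add 2 2 3, Load 4 2, Store 1 4] R)"
        using k unfolding I_def q(1) R'_def[symmetric] by simp
    qed simp
  next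
    fix k j R assume I: "I k R"
    have "(R(3 := 1, 5 := j)) x = R x" if "x \<ge> 6 \<or> x \<in> {0, 1, 2}" for x using that by auto
    moreover have "64 * n - 2 \<ge> 6" "64 * n - 3 + i \<ge> 6" for i using n_pos by auto
    ultimately show "I k (R(3 := 1, 5 := j))" using I unfolding I_def by (simp del: fun_upd_apply)
  qed simp
  let ?is = "[Add 1 1 0, Add 1 1 1, Add 1 1 1, Add 1 1 1, Add 1 1 1, Add 1 1 1, Add 1 1 1,
              Store 1 3, Const 3 1, Sub 1 1 3, Store 1 2, Add 1 1 3, Add 1 1 3, Store 1 4,
              Add 1 1 3, Store 1 5, Add 5 0 0, Add 5 5 0, Const 2 5]"
  have start: "triple (\<lambda>R. R = ?E) (block ?is) (length ?is) (\<lambda>R. R 5 = 3 * n \<and> I (3 * n) R)"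
  proof (rule triple_block)
    fix R assume R: "R = ?E"
    define R' where "R' = run ?is R"
    \<comment> \<open>Intermediate register files, split at the stores. Register 3 is saved before
      the others since its place is needed for the constant 1 that moves the address.\<close>
    define R1 where "R1 = ?E(1 := 64 * n)"
    define R2 where "R2 = R1(64 * n := ?E 3, 3 := 1, 1 := 64 * n - 1)"
    define R3 where "R3 = R2(64 * n - 1 := ?E 2, 1 := 64 * n + 1)"
    define R4 where "R4 = R3(64 * n + 1 := ?E 4, 1 := 64 * n + 2)"
    have far: "64 * n \<ge> 64" "64 * n - 1 \<ge> 63" using n_pos by auto
    have "run [Add 1 1 0, Add 1 1 1, Add 1 1 1, Add 1 1 1, Add 1 1 1, Add 1 1 1, Add 1 1 1] ?E = R1"
      using m0 E0 unfolding R1_def by (auto simp: fun_eq_iff)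
    moreover have "run [Store 1 3, Const 3 1, Sub 1 1 3] R1 = R2"
      using far unfolding R2_def by (simp add: R1_def)
    moreover have "run [Store 1 2, Add 1 1 3, Add 1 1 3] R2 = R3"
    proof -
      have "R2 1 = 64 * n - 1" "R2 3 = 1" "R2 2 = ?E 2" using far by (auto simp: R2_def R1_def)
      then show ?thesis using far unfolding R3_def by simp
    qed
    moreover have "run [Store 1 4, Add 1 1 3] R3 = R4"
    proof -
      have "R3 1 = 64 * n + 1" "R3 3 = 1" "R3 4 = ?E 4" using far by (auto simp: R3_def R2_def R1_def)
      then show ?thesis using far unfolding R4_def by simp
    qed
    moreover have "run [Store 1 5, Add 5 0 0, Add 5 5 0, Const 2 5] R4
        = R4(64 * n + 2 := ?E 5, 5 := n + n + n, 2 := 5)"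
    proof -
      have "R4 1 = 64 * n + 2" "R4 0 = n" "R4 5 = ?E 5" using far E0 by (auto simp: R4_def R3_def R2_def R1_def)
      then show ?thesis using far by simp
    qed
    moreover have "?is = [Add 1 1 0, Add 1 1 1, Add 1 1 1, Add 1 1 1, Add 1 1 1, Add 1 1 1, Add 1 1 1]
        @ [Store 1 3, Const 3 1, Sub 1 1 3] @ [Store 1 2, Add 1 1 3, Add 1 1 3] @ [Store 1 4, Add 1 1 3]
        @ [Store 1 5, Add 5 0 0, Add 5 5 0, Const 2 5]" by simp
    ultimately have "R' = R4(64 * n + 2 := ?E 5, 5 := n + n + n, 2 := 5)"
      unfolding R'_def R by (simp only: run_append)
    note Req = this[unfolded R4_def R3_def R2_def R1_def]
    have "R' (64 * n - 3 + i) = ?E i" if "i \<in> {2..5}" for i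
    proof -
      have idx: "64 * n - 3 + 2 = 64 * n - 1" "64 * n - 3 + 3 = 64 * n" "64 * n - 3 + 4 = 64 * n + 1"
        "64 * n - 3 + 5 = 64 * n + 2" using n_pos by auto
      have "R' (64 * n - 1) = ?E 2" "R' (64 * n) = ?E 3" "R' (64 * n + 1) = ?E 4" "R' (64 * n + 2) = ?E 5"
        using n_pos unfolding Req by auto
      moreover have "i = 2 \<or> i = 3 \<or> i = 4 \<or> i = 5" using that by auto
      ultimately show ?thesis using idx by metis
    qed
    moreover have "R' x = ?E x" if "x \<ge> 6" "x < 64 * n - 2 \<or> x > 64 * n + 2" for x
      using that n_pos by (auto simp: Req)
    moreover have "64 * n - 2 \<notin> {64 * n, 3, 64 * n - 1, 64 * n + 1, 1, 64 * n + 2, 5, 2}" "64 * n - 2 > 3 * n + 3"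
      using n_pos by auto
    then have "R' (64 * n - 2) = 0" using E_high by (simp add: Req)
    moreover have "R' 0 = n" "R' 1 = 64 * n + 2" "R' 2 = 5" "R' 5 = 3 * n"
      using E0 n_pos by (simp_all add: Req)
    ultimately show "run ?is R 5 = 3 * n \<and> I (3 * n) (run ?is R)"
      unfolding I_def R'_def[symmetric] by simp
  qed simp
  show ?thesis
    unfolding relocate_def
  proof (rule triple_conseq[OF triple_seq[OF start loop]])
    fix R assume R: "I 0 R"
    have copied: "R (64 * n - 3 + i) = ?E i" if "i \<in> {2..5 + 3 * n}" for i using R that by (simp add: I_def)
    have "R (64 * n - 2 + 3 * t) = m t \<and> R (64 * n - 1 + 3 * t) = M t \<and> R (64 * n + 3 * t) = of_bool (d t)"
      if t: "t \<le> n" for t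
    proof -
      have "64 * n - 2 + 3 * t = 64 * n - 3 + (3 * t + 1)" "64 * n - 1 + 3 * t = 64 * n - 3 + (3 * t + 2)"
        "64 * n + 3 * t = 64 * n - 3 + (3 * t + 3)" using n_pos by auto
      \<comment> \<open>The entry \<open>m 0\<close> is never copied: it is 0, and so is its target
        cell.\<close>
      moreover have "R (64 * n - 3 + (3 * t + 1)) = m t"
      proof (cases "t = 0")
        case True
        then have "64 * n - 3 + (3 * t + 1) = 64 * n - 2" using n_pos by auto
        then show ?thesis using R True \<open>m 0 = 0\<close> by (simp add: I_def)
      next
        case False
        then show ?thesis using copied[of "3 * t + 1"] t encode_table(1)[OF t] by auto
      qed
      moreover have "3 * t + 2 \<in> {2..5 + 3 * n}" "3 * t + 3 \<in> {2..5 + 3 * n}" using t by auto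
      then have "R (64 * n - 3 + (3 * t + 2)) = M t" "R (64 * n - 3 + (3 * t + 3)) = of_bool (d t)"
        using copied encode_table(2,3)[OF t] by metis+
      ultimately show ?thesis by metis
    qed
    moreover have "R x = 0" if "x \<ge> 128 * n" for x
      using R that n_pos E_high[of x] by (auto simp: I_def)
    ultimately show "R 0 = n \<and> input_at R \<and> (\<forall>x\<ge>128 * n. R x = 0)"
      using R by (auto simp: I_def input_at_def)
  qed (auto simp: relocate_time_def)
qed

lemma input_at_upd [simp]: "r < 32 \<or> r \<ge> 128 * n \<Longrightarrow> input_at (R(r := v)) = input_at R"
proof -
  assume "r < 32 \<or> r \<ge> 128 * n"
  then have "64 * n - 2 + 3 * t \<noteq> r" "64 * n - 1 + 3 * t \<noteq> r" "64 * n + 3 * t \<noteq> r" if "t \<le> n" for t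
    using n_pos that by linarith+
  then show ?thesis by (simp add: input_at_def)
qed

lemma triple_build_rows:
  "triple (\<lambda>R. R 0 = n \<and> input_at R \<and> (\<forall>x\<ge>128 * n. R x = 0)) build_rows (build_rows_time n) (enough {})"
proof -
  \<comment> \<open>Register 9 holds the next free row address; the area from \<open>256 * n\<close>
    on stays zero, which represents the empty relation.\<close>
  define I where "I k R \<longleftrightarrow> fixed_regs R \<and> R 9 = 256 * n + (n + 2 - k) * (n + 2) \<and> input_at R \<and>
    (\<forall>a\<in>{k..n+1}. R (128 * n + a) = row a) \<and> (\<forall>x\<ge>256 * n. R x = 0)" for k R
  let ?body = "[Add 10 4 8, Store 10 9, Add 9 9 7]"
  have loop: "triple (\<lambda>R. R 8 = n + 2 \<and> I (n + 2) R) (loop 8 (block ?body))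
      ((n + 2) * (length ?body + 4) + 1) (I 0)"
  proof (rule triple_loop[where I = I])
    fix k assume k: "k < n + 2"
    show "triple (\<lambda>R. R 8 = k \<and> R 3 = 1 \<and> I (Suc k) R) (block ?body) (length ?body) (\<lambda>R. R 8 = k \<and> I k R)"
    proof (rule triple_block)
      fix R assume R: "R 8 = k \<and> R 3 = 1 \<and> I (Suc k) R"
      have "R 9 = row k" using R by (simp add: I_def row_def)
      then have Req: "run ?body R = R(10 := 128 * n + k, 128 * n + k := row k, 9 := row k + (n + 2))"
        using R n_pos by (simp add: I_def fixed_regs_def)
      have "row k + (n + 2) = 256 * n + (n + 2 - k) * (n + 2)"
      proof -
        have "n + 2 - k = Suc (n + 1 - k)" using k by auto
        then show ?thesis by (simp add: row_def)
      qed
      then have "run ?body R 9 = 256 * n + (n + 2 - k) * (n + 2)" unfolding Req by simp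
      moreover have "run ?body R 8 = k" using R n_pos unfolding Req by simp
      moreover have "fixed_regs (run ?body R)" using R n_pos unfolding Req by (simp add: I_def)
      moreover have "input_at (run ?body R)" using R unfolding Req by (simp add: I_def)
      moreover have "run ?body R (128 * n + a) = row a" if "a \<in> {k..n+1}" for a
        using R that n_pos unfolding Req by (cases "a = k") (auto simp: I_def)
      moreover have "run ?body R x = 0" if "x \<ge> 256 * n" for x
        using R that n_pos k unfolding Req by (auto simp: I_def)
      ultimately show "run ?body R 8 = k \<and> I k (run ?body R)"
        unfolding I_def by blast
    qed simp
  next
    fix k j R assume "I k R"
    then show "I k (R(3 := 1, 8 := j))" using n_pos unfolding I_def by auto
  qed simp
  let ?is = "[Const 1 0, Add 4 0 0, Add 4 4 4, Add 4 4 4, Add 4 4 4, Add 4 4 4, Add 4 4 4,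
              Const 3 1, Sub 5 4 3, Sub 5 5 3, Add 4 4 4, Add 9 4 4, Add 6 0 3, Add 7 6 3, Add 8 7 1]"
  have start: "triple (\<lambda>R. R 0 = n \<and> input_at R \<and> (\<forall>x\<ge>128 * n. R x = 0)) (block ?is) (length ?is)
      (\<lambda>R. R 8 = n + 2 \<and> I (n + 2) R)"
    by (rule triple_block) (use n_pos in \<open>auto simp: I_def fixed_regs_def\<close>)
  show ?thesis
    unfolding build_rows_def
  proof (rule triple_conseq[OF triple_seq[OF start loop]])
    fix R assume R: "I 0 R"
    have "R (row a + b) = 0" for a b using R by (simp add: I_def row_def)
    then have "mem {} R" using R by (auto simp: I_def mem_def)
    then show "enough {} R" using R by (auto simp: I_def enough_def)
  qed (auto simp: build_rows_time_def)
qed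

section \<open>Reading off the answer from the diagonal\<close>

lemma triple_answer:
  "triple (\<lambda>R. fixed_regs R \<and> mem Z R) answer (answer_time n) (\<lambda>R. R 0 = (if irrefl Z then 1 else 0))"
proof -
  define I where "I k R \<longleftrightarrow> fixed_regs R \<and> mem Z R \<and> (R 13 = 0 \<longleftrightarrow> (\<forall>a\<in>{k..n+1}. (a, a) \<notin> Z))" for k R
  let ?ps = "[Test 14 10 10, Arith (Add 13 13 14)]"
  let ?body = "concat (map expand ?ps)"
  have loop: "triple (\<lambda>R. R 10 = n + 2 \<and> I (n + 2) R) (loop 10 (block ?body)) ((n + 2) * (length ?body + 4) + 1) (I 0)"
  proof (rule triple_loop[where I = I])
    fix k assume k: "k < n + 2"
    have *: "{k..n+1} = insert k {Suc k..n+1}" using k by auto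
    show "triple (\<lambda>R. R 10 = k \<and> R 3 = 1 \<and> I (Suc k) R) (block ?body) (length ?body) (\<lambda>R. R 10 = k \<and> I k R)"
    proof (rule triple_block)
      fix R assume R: "R 10 = k \<and> R 3 = 1 \<and> I (Suc k) R"
      have "msafes ?ps (R, Z)" using R k by (auto simp: I_def fixed_regs_def)
      moreover have "mem Z R" using R by (simp add: I_def)
      moreover define R' where "R' = run ?body R"
      ultimately have "rep (mvals ?ps (R, Z)) R'" using rep_mvals rep_self by blast
      then show "run ?body R 10 = k \<and> I k (run ?body R)"
        using R unfolding I_def * R'_def[symmetric] by (auto simp: rep_def fixed_regs_def)
    qed simp
  qed (auto simp: I_def)
  have start: "triple (\<lambda>R. fixed_regs R \<and> mem Z R) (block [Const 13 0, Add 10 7 1]) (length [Const 13 0, Add 10 7 1])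
      (\<lambda>R. R 10 = n + 2 \<and> I (n + 2) R)"
    by (rule triple_block) (auto simp: I_def fixed_regs_def)
  have irrefl: "irrefl Z \<longleftrightarrow> (\<forall>a\<in>{0..n+1}. (a, a) \<notin> Z)"
    using forced_square[OF profile, of d] by (auto simp: irrefl_def)
  have final: "triple (I 0) (block [Const 3 1, Sub 0 3 13]) (length [Const 3 1, Sub 0 3 13])
      (\<lambda>R. R 0 = (if irrefl Z then 1 else 0))"
  proof (rule triple_block)
    fix R assume "I 0 R"
    then have "R 13 = 0 \<longleftrightarrow> irrefl Z" unfolding I_def irrefl by blast
    then show "run [Const 3 1, Sub 0 3 13] R 0 = (if irrefl Z then 1 else 0)" by auto
  qed simp
  show ?thesis
    unfolding answer_def
    by (rule triple_conseq[OF triple_seq[OF start triple_seq[OF loop final]]]) (auto simp: answer_time_def)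
qed

lemma triple_decide:
  "triple (\<lambda>R. R = encode n m M d) decide (decide_time n) (\<lambda>R. R 0 = (if irrefl Z then 1 else 0))"
  unfolding decide_def decide_time_def
  by (rule triple_seq, rule triple_relocate, rule triple_seq, rule triple_build_rows,
      rule triple_seq, rule triple_saturate, rule triple_answer)

end

section \<open>Polynomial time\<close>

text \<open>For \<open>n \<ge> 1\<close> powers grow with the exponent, so bounds by a single
  monomial are closed under sums.\<close>

definition poly_bounded :: "(nat \<Rightarrow> nat) \<Rightarrow> bool" where
  "poly_bounded f \<longleftrightarrow> (\<exists>c k. \<forall>n\<ge>1. f n \<le> c * n ^ k)"

lemma poly_bounded_const: "poly_bounded (\<lambda>n. a)"
  unfolding poly_bounded_def by (intro exI[of _ a] exI[of _ 0]) simp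

lemma poly_bounded_id: "poly_bounded (\<lambda>n. n)"
  unfolding poly_bounded_def by (intro exI[of _ 1]) simp

lemma poly_bounded_add:
  assumes "poly_bounded f" "poly_bounded g" shows "poly_bounded (\<lambda>n. f n + g n)"
proof -
  obtain a k b l where f: "\<And>n. n \<ge> 1 \<Longrightarrow> f n \<le> a * n ^ k" and g: "\<And>n. n \<ge> 1 \<Longrightarrow> g n \<le> b * n ^ l"
    using assms unfolding poly_bounded_def by blast
  have "f n + g n \<le> (a + b) * n ^ (k + l)" if n: "n \<ge> 1" for n
  proof -
    have "a * n ^ k \<le> a * n ^ (k + l)" "b * n ^ l \<le> b * n ^ (k + l)"
      using n by (auto intro!: mult_left_mono power_increasing)
    then show ?thesis using f[OF n] g[OF n] unfolding add_mult_distrib by linarith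
  qed
  then show ?thesis unfolding poly_bounded_def by blast
qed

lemma poly_bounded_mult:
  assumes "poly_bounded f" "poly_bounded g" shows "poly_bounded (\<lambda>n. f n * g n)"
proof -
  obtain a k b l where f: "\<And>n. n \<ge> 1 \<Longrightarrow> f n \<le> a * n ^ k" and g: "\<And>n. n \<ge> 1 \<Longrightarrow> g n \<le> b * n ^ l"
    using assms unfolding poly_bounded_def by blast
  have "f n * g n \<le> (a * b) * n ^ (k + l)" if n: "n \<ge> 1" for n
    using mult_mono[OF f[OF n] g[OF n]] by (simp add: power_add mult_ac)
  then show ?thesis unfolding poly_bounded_def by blast
qed

lemma poly_bounded_decide_time: "poly_bounded decide_time"
  unfolding decide_time_def[abs_def] relocate_time_def build_rows_time_def saturate_time_def
    pass_time_def answer_time_def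
  by (intro poly_bounded_add poly_bounded_mult poly_bounded_const poly_bounded_id)

theorem theorem1:
  shows "\<exists>(p :: instr list) (c :: nat) (k :: nat).
           \<forall>n m M d. n \<ge> 1 \<and> is_profile n m M \<and> linear_profile n m M \<longrightarrow>
             (\<exists>s. s \<le> c * n ^ k + c \<and>
                  halts_within p (encode n m M d) s (if realizable n m M d then 1 else 0))"
proof -
  obtain c k where ck: "\<And>n. n \<ge> 1 \<Longrightarrow> decide_time n \<le> c * n ^ k"
    using poly_bounded_decide_time unfolding poly_bounded_def by blast
  \<comment> \<open>The program \<open>decide 0\<close>, placed at address 0, is the same for all
    inputs, as are \<open>c\<close> and \<open>k\<close>.\<close>
  have "\<exists>s. s \<le> c * n ^ k + c \<and> halts_within (decide 0) (encode n m M d) s (if realizable n m M d then 1 else 0)"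
    if A: "n \<ge> 1 \<and> is_profile n m M \<and> linear_profile n m M" for n m M d
  proof -
    interpret machine_input n m M d using A by unfold_locales auto
    obtain s where "s \<le> decide_time n"
      "halts_within (decide 0) (encode n m M d) s (if irrefl (forced n m M d) then 1 else 0)"
      using triple_halts_within[OF triple_decide refl] by blast
    then show ?thesis
      using A ck[of n] realizable_iff_irrefl_forced[of n m M d] by (intro exI[of _ s]) auto
  qed
  then show ?thesis by blast
qed

end
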